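(* There is an algorithm on a random access machine which, given $n,m\in\mathbb{N}$ with $n,m\ge1$ and $X\in\mathrm{IS}$ with $\mathrm{len}(X)=L(n)+m$, decides whether $X$ computes $\mathrm{tstnz}_n$ in time $O((n+m)\cdot 2^n)$.
   Context: Basic instructions: $\mathtt{in}{:}i.\mathtt{get}$ ($i\ge1$), $\mathtt{out}.\mathtt{set}{:}b$ ($b\in\{0,1\}$), $\mathtt{aux}{:}i.\mathtt{get}$ ($i\ge1$), $\mathtt{aux}{:}i.\mathtt{set}{:}b$ ($i\ge1$, $b\in\{0,1\}$). The part before the dot names a Boolean register ($\mathtt{in}{:}i$ input, $\mathtt{out}$ output, $\mathtt{aux}{:}i$ auxiliary); $\mathtt{get}$ changes nothing and replies the content, $\mathtt{set}{:}b$ makes the content $b$ and replies $b$. Primitive instructions: for each basic instruction $a$, plain $a$, positive test $+a$, negative test $-a$; forward jumps $\#l$ ($l\in\mathbb{N}$); termination $!$. $\mathrm{IS}$ is the set of finite sequences $X=u_1;\dots;u_k$ of primitive instructions, $\mathrm{len}(X)=k$. Execution starts at $u_1$: plain $a$ executes $a$ and proceeds with the next instruction; $+a$ executes $a$ and proceeds with the next instruction if the reply is $1$, otherwise skips the next one and proceeds with the one after it; $-a$ likewise with replies reversed; $\#l$ proceeds with the $l$-th next instruction; $!$ terminates. If $l=0$ or there is no instruction to proceed with, execution never terminates. For $f:\{0,1\}^n\to\{0,1\}$, $X$ computes $f$ if there is $k$ such that for all $b_1,\dots,b_n$, executing $X$ with $\mathtt{in}{:}i$ initially $b_i$, $\mathtt{out}$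 and $\mathtt{aux}{:}1,\dots,\mathtt{aux}{:}k$ initially $0$ (other registers arbitrary) terminates with final content of $\mathtt{out}$ equal to $f(b_1,\dots,b_n)$. $\mathrm{tstnz}_n(b_1,\dots,b_n)=1$ iff some $b_i=1$. $L(n)=3n/2+1$ for even $n$, $3(n+1)/2$ for odd $n$. Model: random access machine in the sense of Cook and Reckhow (without multiplication/division), uniform cost criterion; each primitive instruction of the input is represented by two integers (its form and its natural-number parameter, or $-1$ if none).
   Formalization: "Other registers arbitrary" is read as: a register in:i with i > n may also be absent, and accessing an absent register never terminates; with all registers always readable the claim would, for n = 1, decide a coNP-hard problem in time O(m). *)

theory Defs imports Main begin

datatype reg = In nat | Out | Aux nat

datatype basic = InGet nat | OutSet bool | AuxGet nat | AuxSet nat bool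

datatype prim = Plain basic | Pos basic | Neg basic | Jump nat | Halt

fun wf_basic :: "basic \<Rightarrow> bool" where
  "wf_basic (InGet i) = (1 \<le> i)"
| "wf_basic (OutSet b) = True"
| "wf_basic (AuxGet i) = (1 \<le> i)"
| "wf_basic (AuxSet i b) = (1 \<le> i)"

fun wf_prim :: "prim \<Rightarrow> bool" where
  "wf_prim (Plain a) = wf_basic a"
| "wf_prim (Pos a) = wf_basic a"
| "wf_prim (Neg a) = wf_basic a"
| "wf_prim (Jump l) = True"
| "wf_prim Halt = True"

definition IS :: "prim list set" where
  "IS = {X. \<forall>u \<in> set X. wf_prim u}"

text \<open>
  A state gives the contents of the Boolean registers that are present in the environment in which
  an instruction sequence is executed; \<open>None\<close> means that the register is absent. A basic instruction
  that refers to an absent register cannot be executed, so execution does not terminate.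
\<close>

type_synonym state = "reg \<rightharpoonup> bool"

definition get_reg :: "reg \<Rightarrow> state \<Rightarrow> (bool \<times> state) option" where
  "get_reg r \<sigma> = (case \<sigma> r of None \<Rightarrow> None | Some b \<Rightarrow> Some (b, \<sigma>))"

definition set_reg :: "reg \<Rightarrow> bool \<Rightarrow> state \<Rightarrow> (bool \<times> state) option" where
  "set_reg r b \<sigma> = (case \<sigma> r of None \<Rightarrow> None | Some _ \<Rightarrow> Some (b, \<sigma>(r \<mapsto> b)))"

fun exec_basic :: "basic \<Rightarrow> state \<Rightarrow> (bool \<times> state) option" where
  "exec_basic (InGet i) = get_reg (In i)"
| "exec_basic (OutSet b) = set_reg Out b"
| "exec_basic (AuxGet i) = get_reg (Aux i)"
| "exec_basic (AuxSet i b) = set_reg (Aux i) b"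

text \<open>
  \<open>exec X p \<sigma> \<tau>\<close>: execution of \<open>X\<close> from position \<open>p\<close> (counted from 0) in state \<open>\<sigma>\<close> terminates in
  state \<open>\<tau>\<close>.
\<close>

inductive exec :: "prim list \<Rightarrow> nat \<Rightarrow> state \<Rightarrow> state \<Rightarrow> bool" for X where
  exec_Plain: "p < length X \<Longrightarrow> X ! p = Plain a \<Longrightarrow> exec_basic a \<sigma> = Some (b, \<sigma>') \<Longrightarrow>
    exec X (p + 1) \<sigma>' \<tau> \<Longrightarrow> exec X p \<sigma> \<tau>"
| exec_Pos: "p < length X \<Longrightarrow> X ! p = Pos a \<Longrightarrow> exec_basic a \<sigma> = Some (b, \<sigma>') \<Longrightarrow>
    exec X (if b then p + 1 else p + 2) \<sigma>' \<tau> \<Longrightarrow> exec X p \<sigma> \<tau>"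
| exec_Neg: "p < length X \<Longrightarrow> X ! p = Neg a \<Longrightarrow> exec_basic a \<sigma> = Some (b, \<sigma>') \<Longrightarrow>
    exec X (if b then p + 2 else p + 1) \<sigma>' \<tau> \<Longrightarrow> exec X p \<sigma> \<tau>"
| exec_Jump: "p < length X \<Longrightarrow> X ! p = Jump l \<Longrightarrow> l \<noteq> 0 \<Longrightarrow>
    exec X (p + l) \<sigma> \<tau> \<Longrightarrow> exec X p \<sigma> \<tau>"
| exec_Halt: "p < length X \<Longrightarrow> X ! p = Halt \<Longrightarrow> exec X p \<sigma> \<sigma>"

definition initial_state :: "bool list \<Rightarrow> nat \<Rightarrow> state \<Rightarrow> bool" where
  "initial_state bs k \<sigma> \<longleftrightarrow>
     (\<forall>i \<in> {1..length bs}. \<sigma> (In i) = Some (bs ! (i - 1))) \<and>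
     \<sigma> Out = Some False \<and>
     (\<forall>i \<in> {1..k}. \<sigma> (Aux i) = Some False)"

text \<open>
  The registers that \<open>initial_state\<close> does not mention are arbitrary: they may contain either value
  or be absent. An \<open>X\<close> that gets to read an input register \<open>In i\<close> with \<open>i > n\<close> therefore does not
  compute any \<open>n\<close>-ary function; for an \<open>X\<close> in which no such register occurs, absence makes no
  difference (lemma \<open>computes_iff_total\<close>).
\<close>

definition computes :: "nat \<Rightarrow> prim list \<Rightarrow> (bool list \<Rightarrow> bool) \<Rightarrow> bool" where
  "computes n X f \<longleftrightarrow>
     (\<exists>k. \<forall>bs \<sigma>. length bs = n \<longrightarrow> initial_state bs k \<sigma> \<longrightarrow>
        (\<exists>\<tau>. exec X 0 \<sigma> \<tau> \<and> \<tau> Out = Some (f bs)))"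

fun basic_reg :: "basic \<Rightarrow> reg" where
  "basic_reg (InGet i) = In i"
| "basic_reg (OutSet b) = Out"
| "basic_reg (AuxGet i) = Aux i"
| "basic_reg (AuxSet i b) = Aux i"

fun prim_regs :: "prim \<Rightarrow> reg set" where
  "prim_regs (Plain a) = {basic_reg a}"
| "prim_regs (Pos a) = {basic_reg a}"
| "prim_regs (Neg a) = {basic_reg a}"
| "prim_regs (Jump l) = {}"
| "prim_regs Halt = {}"

definition regs :: "prim list \<Rightarrow> reg set" where
  "regs X = (\<Union>u \<in> set X. prim_regs u)"

lemma exec_basic_agree:
  assumes "exec_basic a \<sigma> = Some (b, \<sigma>')" "\<forall>r\<in>R. \<sigma> r = \<rho> r" "basic_reg a \<in> R"
  shows "\<exists>\<rho>'. exec_basic a \<rho> = Some (b, \<rho>') \<and> (\<forall>r\<in>R. \<sigma>' r = \<rho>' r)"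
  using assms by (cases a) (auto simp: get_reg_def set_reg_def split: option.splits)

lemma exec_agree:
  assumes "exec X p \<sigma> \<tau>" "\<forall>r\<in>R. \<sigma> r = \<rho> r" "regs X \<subseteq> R"
  shows "\<exists>\<tau>'. exec X p \<rho> \<tau>' \<and> (\<forall>r\<in>R. \<tau> r = \<tau>' r)"
  using assms
proof (induction arbitrary: \<rho> rule: exec.induct)
  case (exec_Plain p a \<sigma> b \<sigma>' \<tau>)
  have "prim_regs (X ! p) \<subseteq> R"
    using exec_Plain.hyps(1) exec_Plain.prems(2) nth_mem by (fastforce simp: regs_def)
  then have "basic_reg a \<in> R"
    using exec_Plain.hyps(2) by simp
  then obtain \<rho>' where \<rho>': "exec_basic a \<rho> = Some (b, \<rho>')" "\<forall>r\<in>R. \<sigma>' r = \<rho>' r"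
    using exec_basic_agree[OF exec_Plain.hyps(3) exec_Plain.prems(1)] by blast
  from exec_Plain.IH[OF \<rho>'(2) exec_Plain.prems(2)] show ?case
    using exec.exec_Plain[OF exec_Plain.hyps(1,2) \<rho>'(1)] by blast
next
  case (exec_Pos p a \<sigma> b \<sigma>' \<tau>)
  have "prim_regs (X ! p) \<subseteq> R"
    using exec_Pos.hyps(1) exec_Pos.prems(2) nth_mem by (fastforce simp: regs_def)
  then have "basic_reg a \<in> R"
    using exec_Pos.hyps(2) by simp
  then obtain \<rho>' where \<rho>': "exec_basic a \<rho> = Some (b, \<rho>')" "\<forall>r\<in>R. \<sigma>' r = \<rho>' r"
    using exec_basic_agree[OF exec_Pos.hyps(3) exec_Pos.prems(1)] by blast
  from exec_Pos.IH[OF \<rho>'(2) exec_Pos.prems(2)] show ?case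
    using exec.exec_Pos[OF exec_Pos.hyps(1,2) \<rho>'(1)] by blast
next
  case (exec_Neg p a \<sigma> b \<sigma>' \<tau>)
  have "prim_regs (X ! p) \<subseteq> R"
    using exec_Neg.hyps(1) exec_Neg.prems(2) nth_mem by (fastforce simp: regs_def)
  then have "basic_reg a \<in> R"
    using exec_Neg.hyps(2) by simp
  then obtain \<rho>' where \<rho>': "exec_basic a \<rho> = Some (b, \<rho>')" "\<forall>r\<in>R. \<sigma>' r = \<rho>' r"
    using exec_basic_agree[OF exec_Neg.hyps(3) exec_Neg.prems(1)] by blast
  from exec_Neg.IH[OF \<rho>'(2) exec_Neg.prems(2)] show ?case
    using exec.exec_Neg[OF exec_Neg.hyps(1,2) \<rho>'(1)] by blast
next
  case (exec_Jump p l \<sigma> \<tau>)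
  from exec_Jump.IH[OF exec_Jump.prems] show ?case
    using exec.exec_Jump[OF exec_Jump.hyps(1-3)] by blast
next
  case (exec_Halt p \<sigma>)
  from exec.exec_Halt[OF exec_Halt.hyps] exec_Halt.prems(1) show ?case by blast
qed

lemma finite_regs: "finite (regs X)"
proof -
  have "finite (prim_regs u)" for u by (cases u) auto
  then show ?thesis by (simp add: regs_def)
qed

lemma IS_regs:
  assumes "X \<in> IS" "In i \<in> regs X \<or> Aux i \<in> regs X"
  shows "1 \<le> i"
proof -
  obtain u where u: "u \<in> set X" "In i \<in> prim_regs u \<or> Aux i \<in> prim_regs u"
    using assms(2) by (auto simp: regs_def)
  have "wf_prim u" using assms(1) u(1) by (auto simp: IS_def)
  moreover have "1 \<le> i" if "wf_basic a" "In i = basic_reg a \<or> Aux i = basic_reg a" for a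
    using that by (cases a) auto
  ultimately show ?thesis using u(2) by (cases u) auto
qed

lemma computes_iff_total:
  assumes "X \<in> IS" "\<forall>i. In i \<in> regs X \<longrightarrow> i \<le> n"
  shows "computes n X f \<longleftrightarrow>
     (\<exists>k. \<forall>bs \<sigma>. length bs = n \<longrightarrow> dom \<sigma> = UNIV \<longrightarrow> initial_state bs k \<sigma> \<longrightarrow>
        (\<exists>\<tau>. exec X 0 \<sigma> \<tau> \<and> \<tau> Out = Some (f bs)))" (is "?L \<longleftrightarrow> ?R")
proof
  assume ?L
  then show ?R unfolding computes_def by blast
next
  assume ?R
  then obtain k where k: "\<And>bs \<sigma>. length bs = n \<Longrightarrow> dom \<sigma> = UNIV \<Longrightarrow> initial_state bs k \<sigma> \<Longrightarrow>
        \<exists>\<tau>. exec X 0 \<sigma> \<tau> \<and> \<tau> Out = Some (f bs)" by blast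
  have "finite (Aux -` regs X)"
    by (rule finite_vimageI[OF finite_regs]) (simp add: inj_def)
  then obtain j where j: "\<And>i. Aux i \<in> regs X \<Longrightarrow> i \<le> j"
    using finite_nat_set_iff_bounded_le by (metis vimageI)
  show ?L unfolding computes_def
  proof (intro exI[of _ "max j k"] allI impI)
    fix bs \<sigma>
    assume bs: "length bs = n" and init: "initial_state bs (max j k) \<sigma>"
    define \<rho> where "\<rho> = (\<lambda>_. Some False) ++ \<sigma>"
    have total: "dom \<rho> = UNIV" by (auto simp: \<rho>_def)
    have agree: "\<rho> r = \<sigma> r" if "r \<in> dom \<sigma>" for r
      using that by (auto simp: \<rho>_def map_add_dom_app_simps)
    have "initial_state bs k \<rho>"
      using init by (auto simp: initial_state_def \<rho>_def map_add_def)
    then obtain \<tau> where \<tau>: "exec X 0 \<rho> \<tau>" "\<tau> Out = Some (f bs)"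
      using k[OF bs total] by blast
    have "r \<in> dom \<sigma>" if r: "r \<in> insert Out (regs X)" for r
    proof (cases r)
      case (In i)
      then have "i \<in> {1..length bs}"
        using r assms(2) IS_regs[OF assms(1)] bs by auto
      then show ?thesis using init In unfolding initial_state_def by blast
    next
      case Out
      then show ?thesis using init by (auto simp: initial_state_def)
    next
      case (Aux i)
      then have "i \<in> {1..max j k}"
        using r IS_regs[OF assms(1)] j[of i] by auto
      then show ?thesis using init Aux unfolding initial_state_def by blast
    qed
    then have "\<forall>r \<in> insert Out (regs X). \<rho> r = \<sigma> r"
      using agree by blast
    from exec_agree[OF \<tau>(1) this subset_insertI] \<tau>(2)
    show "\<exists>\<tau>. exec X 0 \<sigma> \<tau> \<and> \<tau> Out = Some (f bs)" by (metis insertI1)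
  qed
qed

definition tstnz :: "bool list \<Rightarrow> bool" where
  "tstnz bs \<longleftrightarrow> (\<exists>b \<in> set bs. b)"

definition tstnz_len :: "nat \<Rightarrow> nat" where
  "tstnz_len n = (if even n then 3 * n div 2 + 1 else 3 * (n + 1) div 2)"

text \<open>
  The random access machine of Cook and Reckhow: registers \<open>X\<^sub>0, X\<^sub>1, \<dots>\<close> hold arbitrary integers.
  \<open>Load i j\<close> is \<open>X\<^sub>i \<leftarrow> X\<close> indexed by the content of \<open>X\<^sub>j\<close>, \<open>Store i j\<close> assigns the content of \<open>X\<^sub>j\<close> to the
  register indexed by the content of \<open>X\<^sub>i\<close>, and \<open>Tra l j\<close> transfers control to line \<open>l\<close> (counted from 0)
  if the content of \<open>X\<^sub>j\<close> is positive.
\<close>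

datatype ram_instr =
    Const nat int
  | Add nat nat nat
  | Sub nat nat nat
  | Load nat nat
  | Store nat nat
  | Tra nat nat
  | Read nat
  | Print nat

record ram_conf =
  line :: nat
  mem :: "nat \<Rightarrow> int"
  inp :: "int list"
  outp :: "int list"

text \<open>
  A negative address and reading past the end of the input are errors: the machine has no next
  configuration, but it has not halted in the sense of \<open>ram_halts\<close> below.
\<close>

fun ram_exec :: "ram_instr \<Rightarrow> ram_conf \<Rightarrow> ram_conf option" where
  "ram_exec (Const i c) s = Some (s\<lparr>line := line s + 1, mem := (mem s)(i := c)\<rparr>)"
| "ram_exec (Add i j k) s =
     Some (s\<lparr>line := line s + 1, mem := (mem s)(i := mem s j + mem s k)\<rparr>)"
| "ram_exec (Sub i j k) s =
     Some (s\<lparr>line := line s + 1, mem := (mem s)(i := mem s j - mem s k)\<rparr>)"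
| "ram_exec (Load i j) s =
     (if mem s j < 0 then None
      else Some (s\<lparr>line := line s + 1, mem := (mem s)(i := mem s (nat (mem s j)))\<rparr>))"
| "ram_exec (Store i j) s =
     (if mem s i < 0 then None
      else Some (s\<lparr>line := line s + 1, mem := (mem s)(nat (mem s i) := mem s j)\<rparr>))"
| "ram_exec (Tra l j) s = Some (s\<lparr>line := if mem s j > 0 then l else line s + 1\<rparr>)"
| "ram_exec (Read i) s =
     (case inp s of [] \<Rightarrow> None
      | x # xs \<Rightarrow> Some (s\<lparr>line := line s + 1, mem := (mem s)(i := x), inp := xs\<rparr>))"
| "ram_exec (Print i) s = Some (s\<lparr>line := line s + 1, outp := outp s @ [mem s i]\<rparr>)"

text \<open>
  \<open>ram_halts P t s s'\<close>: program \<open>P\<close> started in \<open>s\<close> halts in \<open>s'\<close> (control has left the program) after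
  exactly \<open>t\<close> instructions, i.e. in time \<open>t\<close> under the uniform cost criterion.
\<close>

inductive ram_halts :: "ram_instr list \<Rightarrow> nat \<Rightarrow> ram_conf \<Rightarrow> ram_conf \<Rightarrow> bool" for P where
  ram_halts_0: "length P \<le> line s \<Longrightarrow> ram_halts P 0 s s"
| ram_halts_Suc: "line s < length P \<Longrightarrow> ram_exec (P ! line s) s = Some s' \<Longrightarrow>
    ram_halts P t s' s'' \<Longrightarrow> ram_halts P (Suc t) s s''"

definition ram_init :: "int list \<Rightarrow> ram_conf" where
  "ram_init xs = \<lparr>line = 0, mem = (\<lambda>_. 0), inp = xs, outp = []\<rparr>"

definition ram_maps :: "ram_instr list \<Rightarrow> nat \<Rightarrow> int list \<Rightarrow> int list \<Rightarrow> bool" where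
  "ram_maps P t xs ys \<longleftrightarrow> (\<exists>s. ram_halts P t (ram_init xs) s \<and> outp s = ys)"

fun basic_form :: "basic \<Rightarrow> int" where
  "basic_form (InGet i) = 0"
| "basic_form (OutSet b) = (if b then 2 else 1)"
| "basic_form (AuxGet i) = 3"
| "basic_form (AuxSet i b) = (if b then 5 else 4)"

fun basic_param :: "basic \<Rightarrow> int" where
  "basic_param (InGet i) = int i"
| "basic_param (OutSet b) = -1"
| "basic_param (AuxGet i) = int i"
| "basic_param (AuxSet i b) = int i"

fun encode_prim :: "prim \<Rightarrow> int list" where
  "encode_prim (Plain a) = [basic_form a, basic_param a]"
| "encode_prim (Pos a) = [6 + basic_form a, basic_param a]"
| "encode_prim (Neg a) = [12 + basic_form a, basic_param a]"
| "encode_prim (Jump l) = [18, int l]"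
| "encode_prim Halt = [19, -1]"

definition encode_input :: "nat \<Rightarrow> nat \<Rightarrow> prim list \<Rightarrow> int list" where
  "encode_input n m X = int n # int m # concat (map encode_prim X)"

end

theory Submission imports Defs begin

text \<open>
  Brute force suffices. All jumps are forward, so an execution of \<open>X\<close> that terminates does so within
  \<open>length X\<close> steps; since \<open>length X \<le> 3 (n + m)\<close>, simulating \<open>X\<close> on each of the \<open>2 ^ n\<close> inputs takes time
  \<open>O((n + m) 2 ^ n)\<close>, provided that an input vector can be set up, and the auxiliary registers reset, in
  time \<open>O(n + m)\<close>. Registers not mentioned in the initial state may be absent, and execution is
  monotone in the set of registers present, so it is enough to run \<open>X\<close> with exactly the \<open>n\<close> input
  registers, the output register and all auxiliary registers present.
\<close>

section \<open>A structured language on top of the RAM\<close>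

text \<open>The indices of the auxiliary registers in \<open>X\<close> are not bounded in terms of
  \<open>n\<close> and \<open>m\<close>, so no block of cells containing them can be cleared between
  two input vectors in the time available. Instead, a register counts as true only if its cell holds
  a stamp that belongs to the current vector; incrementing the number of the vector invalidates all
  old stamps at unit cost. Under the uniform cost criterion, indirect addressing reaches a cell of
  any index in one instruction. Vectors are enumerated as the numbers \<open>x < 2 ^ n\<close>, so
  that the expected output is simply whether \<open>x\<close> is positive. Correctness and time are
  handled by one judgement: loop-free code takes no more instructions than it contains, so costs
  have to be added up only at the five loops.\<close>

type_synonym store = "(nat \<Rightarrow> int) \<times> int list \<times> int list"

definition conf :: "nat \<Rightarrow> store \<Rightarrow> ram_conf" where
  "conf l s = \<lparr>line = l, mem = fst s, inp = fst (snd s), outp = snd (snd s)\<rparr>"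

text \<open>
  Both control structures need a single conditional transfer: \<open>Unless j c\<close> skips \<open>c\<close> and \<open>Repeat c j\<close> runs
  \<open>c\<close> again if the content of \<open>X\<^sub>j\<close> is positive. The RAM has no
  unconditional jump.
\<close>

datatype com = Atom ram_instr | Seq com com (infixr ";;" 60) | Unless nat com | Repeat com nat

primrec clen :: "com \<Rightarrow> nat" where
  "clen (Atom a) = 1"
| "clen (c ;; d) = clen c + clen d"
| "clen (Unless j c) = Suc (clen c)"
| "clen (Repeat c j) = Suc (clen c)"

primrec compile :: "com \<Rightarrow> nat \<Rightarrow> ram_instr list" where
  "compile (Atom a) l = [a]"
| "compile (c ;; d) l = compile c l @ compile d (l + clen c)"
| "compile (Unless j c) l = Tra (Suc l + clen c) j # compile c (Suc l)"
| "compile (Repeat c j) l = compile c l @ [Tra l j]"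

lemma length_compile [simp]: "length (compile c l) = clen c"
  by (induction c arbitrary: l) auto

definition code_at :: "ram_instr list \<Rightarrow> nat \<Rightarrow> ram_instr list \<Rightarrow> bool" where
  "code_at P l c \<longleftrightarrow> (\<exists>A B. P = A @ c @ B \<and> length A = l)"

lemma code_at_append:
  assumes "code_at P l (c @ d)"
  shows "code_at P l c" "code_at P (l + length c) d"
proof -
  obtain A B where "P = A @ (c @ d) @ B" "length A = l"
    using assms by (auto simp: code_at_def)
  then have "P = A @ c @ (d @ B)" "P = (A @ c) @ d @ B" "length (A @ c) = l + length c"
    by auto
  then show "code_at P l c" "code_at P (l + length c) d"
    using \<open>length A = l\<close> unfolding code_at_def by blast+
qed

lemma code_at_Cons:
  assumes "code_at P l (a # c)"
  shows "l < length P" "P ! l = a" "code_at P (Suc l) c"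
proof -
  show "l < length P" "P ! l = a"
    using assms by (auto simp: code_at_def nth_append)
  show "code_at P (Suc l) c"
    using code_at_append(2)[of P l "[a]" c] assms by simp
qed

text \<open>
  Speaking about the continuations that halt makes a separate step relation unnecessary.
\<close>

definition within :: "nat \<Rightarrow> com \<Rightarrow> (store \<Rightarrow> bool) \<Rightarrow> store \<Rightarrow> bool" where
  "within T c Q s \<longleftrightarrow> (\<forall>P l. code_at P l (compile c l) \<longrightarrow>
     (\<exists>t s'. t \<le> T \<and> Q s' \<and>
        (\<forall>t' z. ram_halts P t' (conf (l + clen c) s') z \<longrightarrow> ram_halts P (t + t') (conf l s) z)))"

lemma ram_halts_step:
  assumes "l < length P" "ram_exec (P ! l) (conf l s) = Some z'" "ram_halts P t z' z"
  shows "ram_halts P (Suc t) (conf l s) z"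
  using ram_halts_Suc[of "conf l s" P z' t z] assms by (simp add: conf_def)

lemma ram_exec_Tra:
  "ram_exec (Tra l' j) (conf l s) = Some (conf (if 0 < fst s j then l' else Suc l) s)"
  by (simp add: conf_def)

lemma within_mono:
  assumes "within T c Q s" "T \<le> T'" "\<And>s. Q s \<Longrightarrow> Q' s"
  shows "within T' c Q' s"
  unfolding within_def
proof (intro allI impI)
  fix P l
  assume "code_at P l (compile c l)"
  with assms(1) obtain t s' where "t \<le> T" "Q s'"
    "\<forall>t' z. ram_halts P t' (conf (l + clen c) s') z \<longrightarrow> ram_halts P (t + t') (conf l s) z"
    unfolding within_def by meson
  with assms(2,3) show "\<exists>t s'. t \<le> T' \<and> Q' s' \<and>
    (\<forall>t' z. ram_halts P t' (conf (l + clen c) s') z \<longrightarrow> ram_halts P (t + t') (conf l s) z)"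
    by (meson order_trans)
qed

lemma within_Atom:
  assumes "\<And>l. ram_exec a (conf l s) = Some (conf (Suc l) s')" "Q s'"
  shows "within 1 (Atom a) Q s"
  unfolding within_def
proof (intro allI impI)
  fix P l
  assume "code_at P l (compile (Atom a) l)"
  then have "l < length P" "P ! l = a"
    by (auto dest: code_at_Cons)
  then show "\<exists>t s'. t \<le> 1 \<and> Q s' \<and> (\<forall>t' z. ram_halts P t' (conf (l + clen (Atom a)) s') z \<longrightarrow>
    ram_halts P (t + t') (conf l s) z)"
    using assms ram_halts_step[of l P s] by (intro exI[of _ 1] exI[of _ s']) auto
qed

lemma within_Seq:
  assumes "within T c R s" "\<And>s'. R s' \<Longrightarrow> within T' d Q s'"
  shows "within (T + T') (c ;; d) Q s"
  unfolding within_def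
proof (intro allI impI)
  fix P l
  assume "code_at P l (compile (c ;; d) l)"
  then have code: "code_at P l (compile c l)" "code_at P (l + clen c) (compile d (l + clen c))"
    using code_at_append[of P l "compile c l" "compile d (l + clen c)"] by simp_all
  obtain t s' where t: "t \<le> T" "R s'"
    "\<And>t' z. ram_halts P t' (conf (l + clen c) s') z \<Longrightarrow> ram_halts P (t + t') (conf l s) z"
    using assms(1) code(1) unfolding within_def by meson
  obtain u s'' where u: "u \<le> T'" "Q s''"
    "\<And>t' z. ram_halts P t' (conf (l + clen c + clen d) s'') z \<Longrightarrow>
       ram_halts P (u + t') (conf (l + clen c) s') z"
    using assms(2)[OF t(2)] code(2) unfolding within_def by meson
  have "ram_halts P (t + u + t') (conf l s) z"
    if "ram_halts P t' (conf (l + clen (c ;; d)) s'') z" for t' z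
    using t(3)[OF u(3), of t' z] that by (simp add: add.assoc)
  with t(1) u(1,2) show "\<exists>t s'. t \<le> T + T' \<and> Q s' \<and> (\<forall>t' z.
    ram_halts P t' (conf (l + clen (c ;; d)) s') z \<longrightarrow> ram_halts P (t + t') (conf l s) z)"
    by (meson add_mono)
qed

lemma within_Unless:
  assumes "0 < fst s j \<Longrightarrow> Q s" "\<not> 0 < fst s j \<Longrightarrow> within T c Q s"
  shows "within (Suc T) (Unless j c) Q s"
  unfolding within_def
proof (intro allI impI)
  fix P l
  assume "code_at P l (compile (Unless j c) l)"
  then have code: "l < length P" "P ! l = Tra (Suc l + clen c) j"
    "code_at P (Suc l) (compile c (Suc l))"
    using code_at_Cons[of P l "Tra (Suc l + clen c) j" "compile c (Suc l)"] by simp_all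
  let ?goal = "\<lambda>t s'. t \<le> Suc T \<and> Q s' \<and> (\<forall>t' z.
    ram_halts P t' (conf (l + clen (Unless j c)) s') z \<longrightarrow> ram_halts P (t + t') (conf l s) z)"
  show "\<exists>t s'. ?goal t s'"
  proof (cases "0 < fst s j")
    case True
    then have "?goal 1 s"
      using assms(1) ram_halts_step[OF code(1), unfolded code(2) ram_exec_Tra] by auto
    then show ?thesis by blast
  next
    case False
    then obtain t s' where t: "t \<le> T" "Q s'"
      "\<And>t' z. ram_halts P t' (conf (Suc l + clen c) s') z \<Longrightarrow>
         ram_halts P (t + t') (conf (Suc l) s) z"
      using assms(2) code(3) unfolding within_def by meson
    then have "?goal (Suc t) s'"
      using False ram_halts_step[OF code(1), unfolded code(2) ram_exec_Tra] by auto
    then show ?thesis by blast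
  qed
qed

text \<open>The index of \<open>J\<close> counts completed passes. The test comes after the body, so
  the body has to establish its outcome together with the next instance of \<open>J\<close>, and at
  least one pass is made. Each pass pays one more instruction for the closing
  \<open>Tra\<close>.\<close>

lemma within_Repeat:
  assumes step: "\<And>i s. i < N \<Longrightarrow> J i s \<Longrightarrow>
      within T c (\<lambda>s'. J (Suc i) s' \<and> (0 < fst s' j \<longleftrightarrow> Suc i < N)) s"
    and start: "J 0 s" "0 < N"
  shows "within (N * Suc T) (Repeat c j) (J N) s"
proof -
  \<comment> \<open>Induction on the number \<open>k\<close> of passes left. The transfer leads back
    to the start of the same piece of code, so one assumption on \<open>code_at\<close> serves all
    passes.\<close>
  have "within (k * Suc T) (Repeat c j) (J N) s" if "J i s" "i + k = N" "0 < k" for i k s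
    using that
  proof (induction k arbitrary: i s)
    case 0
    then show ?case by simp
  next
    case (Suc k)
    show ?case
      unfolding within_def
    proof (intro allI impI)
      fix P l
      assume code: "code_at P l (compile (Repeat c j) l)"
      have body: "code_at P l (compile c l)"
        and "code_at P (l + clen c) [Tra l j]"
        using code_at_append[of P l "compile c l" "[Tra l j]"] code by simp_all
      then have test: "l + clen c < length P" "P ! (l + clen c) = Tra l j"
        by (auto dest: code_at_Cons)
      obtain t s' where t: "t \<le> T" "J (Suc i) s'" "0 < fst s' j \<longleftrightarrow> Suc i < N"
        "\<And>t' z. ram_halts P t' (conf (l + clen c) s') z \<Longrightarrow> ram_halts P (t + t') (conf l s) z"
        using step[of i s] Suc.prems body unfolding within_def by (metis less_add_same_cancel1)
      let ?goal = "\<lambda>t s'. t \<le> Suc k * Suc T \<and> J N s' \<and> (\<forall>t' z.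
        ram_halts P t' (conf (l + clen (Repeat c j)) s') z \<longrightarrow> ram_halts P (t + t') (conf l s) z)"
      show "\<exists>t s'. ?goal t s'"
      proof (cases k)
        case 0
        have "ram_halts P (Suc t + t') (conf l s) z"
          if "ram_halts P t' (conf (l + clen (Repeat c j)) s') z" for t' z
          using t(3) t(4)[OF ram_halts_step[OF test(1)], unfolded test(2) ram_exec_Tra, OF refl]
            Suc.prems 0 that by simp
        then have "?goal (Suc t) s'"
          using t(1,2) Suc.prems 0 by simp
        then show ?thesis by blast
      next
        case (Suc k')
        have "within (k * Suc T) (Repeat c j) (J N) s'"
          using Suc.IH[of "Suc i" s'] t(2) Suc Suc.prems by simp
        then obtain u s'' where u: "u \<le> k * Suc T" "J N s''"
          "\<And>t' z. ram_halts P t' (conf (l + clen (Repeat c j)) s'') z \<Longrightarrow>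
             ram_halts P (u + t') (conf l s') z"
          using code unfolding within_def by meson
        have "ram_halts P (Suc t + u + t') (conf l s) z"
          if "ram_halts P t' (conf (l + clen (Repeat c j)) s'') z" for t' z
          using t(3) t(4)[OF ram_halts_step[OF test(1)], unfolded test(2) ram_exec_Tra, OF refl]
            Suc.prems Suc u(3)[OF that] by (simp add: add.assoc)
        then have "?goal (Suc t + u) s''"
          using t(1) u(1,2) by simp
        then show ?thesis by blast
      qed
    qed
  qed
  from this[of 0 s N] start show ?thesis by simp
qed

lemma within_imp_ram_maps:
  assumes "within T c (\<lambda>s. snd (snd s) = ys) (\<lambda>_. 0, xs, [])"
  shows "\<exists>t\<le>T. ram_maps (compile c 0) t xs ys"
proof -
  have "code_at (compile c 0) 0 (compile c 0)"
    by (simp add: code_at_def)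
  then obtain t s' where t: "t \<le> T" "snd (snd s') = ys"
    "\<And>t' z. ram_halts (compile c 0) t' (conf (0 + clen c) s') z \<Longrightarrow>
       ram_halts (compile c 0) (t + t') (conf 0 (\<lambda>_. 0, xs, [])) z"
    using assms unfolding within_def by meson
  \<comment> \<open>\<open>clen c\<close> is the length of the whole program, so control has left
    it; this run of zero steps is the continuation fed to \<open>t(3)\<close>.\<close>
  have "ram_halts (compile c 0) 0 (conf (0 + clen c) s') (conf (0 + clen c) s')"
    by (rule ram_halts_0) (simp add: conf_def)
  from t(3)[OF this] have "ram_halts (compile c 0) t (ram_init xs) (conf (clen c) s')"
    by (simp add: ram_init_def conf_def)
  moreover have "outp (conf (clen c) s') = ys"
    using t(2) by (simp add: conf_def)
  ultimately show ?thesis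
    using t(1) unfolding ram_maps_def by blast
qed

section \<open>Weakest preconditions of loop-free code\<close>

primrec wp :: "com \<Rightarrow> (store \<Rightarrow> bool) \<Rightarrow> store \<Rightarrow> bool" where
  "wp (Atom a) Q s = (\<exists>s'. (\<forall>l. ram_exec a (conf l s) = Some (conf (Suc l) s')) \<and> Q s')"
| "wp (c ;; d) Q s = wp c (wp d Q) s"
| "wp (Unless j c) Q s = (if 0 < fst s j then Q s else wp c Q s)"
| "wp (Repeat c j) Q s = False"

text \<open>Without loops control only moves forward, so the length of the code bounds its time and
  the simplifier can run it symbolically. \<open>False\<close> for \<open>Repeat\<close> makes that
  case vacuous; loops go through \<open>within_Repeat\<close>.\<close>

lemma wp_imp_within: "wp c Q s \<Longrightarrow> within (clen c) c Q s"
proof (induction c arbitrary: Q s)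
  case (Atom a)
  then show ?case using within_Atom[of a s _ Q] by auto
next
  case (Seq c d)
  then show ?case using within_Seq[of "clen c" c "wp d Q" s "clen d" d Q] by simp
next
  case (Unless j c)
  then show ?case using within_Unless[of s j Q "clen c" c] by simp
qed auto

lemma wp_mono: "wp c Q s \<Longrightarrow> (\<And>s. Q s \<Longrightarrow> Q' s) \<Longrightarrow> wp c Q' s"
proof (induction c arbitrary: Q Q' s)
  case (Atom a)
  then show ?case unfolding wp.simps(1) by blast
next
  case (Seq c d)
  from Seq.prems(1) have "wp c (wp d Q) s" by simp
  then have "wp c (wp d Q') s"
    by (rule Seq.IH(1)) (rule Seq.IH(2), assumption, rule Seq.prems(2))
  then show ?case by simp
next
  case (Unless j c)
  from Unless.prems(1) show ?case
    using Unless.IH[OF _ Unless.prems(2)] Unless.prems(2) by (auto split: if_splits)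
qed simp

lemma within_wp: "wp c Q s \<Longrightarrow> clen c \<le> T \<Longrightarrow> within T c Q s"
  using wp_imp_within within_mono by blast

lemma within_wp_Seq:
  assumes "wp c (within T d Q) s" "clen c + T = T'"
  shows "within T' (c ;; d) Q s"
  using assms wp_imp_within within_Seq by blast

lemma conf_inject: "conf l s = conf l s' \<longleftrightarrow> s = s'"
  by (auto simp: conf_def prod_eq_iff)

lemma wp_Atom_iff:
  assumes "\<And>l. ram_exec a (conf l s) = Some (conf (Suc l) s')"
  shows "wp (Atom a) Q s \<longleftrightarrow> Q s'"
  using assms by (auto simp: conf_inject)

lemma wp_Const [simp]: "wp (Atom (Const i c)) Q (m, xs, ys) \<longleftrightarrow> Q (m(i := c), xs, ys)"
  by (rule wp_Atom_iff) (simp add: conf_def)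

lemma wp_Add [simp]: "wp (Atom (Add i j k)) Q (m, xs, ys) \<longleftrightarrow> Q (m(i := m j + m k), xs, ys)"
  by (rule wp_Atom_iff) (simp add: conf_def)

lemma wp_Sub [simp]: "wp (Atom (Sub i j k)) Q (m, xs, ys) \<longleftrightarrow> Q (m(i := m j - m k), xs, ys)"
  by (rule wp_Atom_iff) (simp add: conf_def)

lemma wp_Load [simp]:
  "wp (Atom (Load i j)) Q (m, xs, ys) \<longleftrightarrow> 0 \<le> m j \<and> Q (m(i := m (nat (m j))), xs, ys)"
proof (cases "0 \<le> m j")
  case True
  then have "wp (Atom (Load i j)) Q (m, xs, ys) \<longleftrightarrow> Q (m(i := m (nat (m j))), xs, ys)"
    by (intro wp_Atom_iff) (simp add: conf_def)
  with True show ?thesis by simp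
qed (simp add: conf_def)

lemma wp_Store [simp]:
  "wp (Atom (Store i j)) Q (m, xs, ys) \<longleftrightarrow> 0 \<le> m i \<and> Q (m(nat (m i) := m j), xs, ys)"
proof (cases "0 \<le> m i")
  case True
  then have "wp (Atom (Store i j)) Q (m, xs, ys) \<longleftrightarrow> Q (m(nat (m i) := m j), xs, ys)"
    by (intro wp_Atom_iff) (simp add: conf_def)
  with True show ?thesis by simp
qed (simp add: conf_def)

lemma wp_Read [simp]: "wp (Atom (Read i)) Q (m, x # xs, ys) \<longleftrightarrow> Q (m(i := x), xs, ys)"
  by (rule wp_Atom_iff) (simp add: conf_def)

lemma wp_Print [simp]: "wp (Atom (Print i)) Q (m, xs, ys) \<longleftrightarrow> Q (m, xs, ys @ [m i])"
  by (rule wp_Atom_iff) (simp add: conf_def)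

declare wp.simps(1) [simp del]

text \<open>\<open>Unless\<close> skips on a positive content, hence cell 0 receives the difference
  that is positive when the test fails.\<close>

definition IfGe :: "nat \<Rightarrow> int \<Rightarrow> com \<Rightarrow> com" where
  "IfGe j c d = Atom (Const 0 c) ;; Atom (Sub 0 0 j) ;; Unless 0 d"

definition IfLe :: "nat \<Rightarrow> int \<Rightarrow> com \<Rightarrow> com" where
  "IfLe j c d = Atom (Const 0 c) ;; Atom (Sub 0 j 0) ;; Unless 0 d"

lemma wp_IfGe [simp]:
  "0 < j \<Longrightarrow> wp (IfGe j c d) Q (m, xs, ys) \<longleftrightarrow>
     (if c \<le> m j then wp d Q (m(0 := c - m j), xs, ys) else Q (m(0 := c - m j), xs, ys))"
  by (simp add: IfGe_def)

lemma wp_IfLe [simp]: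
  "0 < j \<Longrightarrow> wp (IfLe j c d) Q (m, xs, ys) \<longleftrightarrow>
     (if m j \<le> c then wp d Q (m(0 := m j - c), xs, ys) else Q (m(0 := m j - c), xs, ys))"
  by (simp add: IfLe_def)

section \<open>Bounded execution of instruction sequences\<close>

text \<open>
  Beyond the end of \<open>X\<close> the memory cells of the RAM are 0, which encodes \<open>Plain (InGet 0)\<close>.
  In \<open>cstep\<close>, an execution that is stuck stays where it is, like one that has terminated, so
  that the simulation can always make exactly \<open>length X\<close> steps.
\<close>

definition fetch :: "prim list \<Rightarrow> nat \<Rightarrow> prim" where
  "fetch X p = (if p < length X then X ! p else Plain (InGet 0))"

fun cstep :: "prim list \<Rightarrow> nat \<times> state \<Rightarrow> nat \<times> state" where
  "cstep X (p, \<sigma>) = (case fetch X p of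
     Plain a \<Rightarrow> (case exec_basic a \<sigma> of None \<Rightarrow> (p, \<sigma>) | Some (b, \<sigma>') \<Rightarrow> (p + 1, \<sigma>'))
   | Pos a \<Rightarrow> (case exec_basic a \<sigma> of None \<Rightarrow> (p, \<sigma>)
       | Some (b, \<sigma>') \<Rightarrow> (if b then p + 1 else p + 2, \<sigma>'))
   | Neg a \<Rightarrow> (case exec_basic a \<sigma> of None \<Rightarrow> (p, \<sigma>)
       | Some (b, \<sigma>') \<Rightarrow> (if b then p + 2 else p + 1, \<sigma>'))
   | Jump l \<Rightarrow> (p + l, \<sigma>)
   | Halt \<Rightarrow> (p, \<sigma>))"

lemma exec_pos_less: "exec X p \<sigma> \<tau> \<Longrightarrow> p < length X"
  by (erule exec.cases) simp_all

text \<open>Positions never decrease and a terminating execution stays below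
  \<open>length X\<close>, so the default of \<open>fetch\<close> is not involved. Where
  \<open>cstep\<close> idles (absent register, \<open>Jump 0\<close>, \<open>Halt\<close>) nothing
  has to be shown.\<close>

lemma exec_if_cstep:
  assumes "exec X p' \<sigma>' \<tau>" "cstep X (p, \<sigma>) = (p', \<sigma>')"
  shows "exec X p \<sigma> \<tau>"
proof -
  have "p \<le> p'"
    using assms(2) by (auto split: prim.splits option.splits if_splits)
  then have p: "p < length X" using exec_pos_less[OF assms(1)] by simp
  show ?thesis
  proof (cases "X ! p")
    case (Plain a)
    then show ?thesis using assms p exec_Plain[OF p Plain]
      by (auto simp: fetch_def split: option.splits)
  next
    case (Pos a)
    then show ?thesis using assms p exec_Pos[OF p Pos]
      by (auto simp: fetch_def split: option.splits)
  next
    case (Neg a)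
    then show ?thesis using assms p exec_Neg[OF p Neg]
      by (auto simp: fetch_def split: option.splits)
  next
    case (Jump l)
    then show ?thesis using assms p exec_Jump[OF p Jump]
      by (cases "l = 0") (auto simp: fetch_def)
  next
    case Halt
    then show ?thesis using assms p by (auto simp: fetch_def)
  qed
qed

lemma exec_if_funpow_cstep:
  assumes "(cstep X ^^ N) (p, \<sigma>) = (p', \<tau>)" "fetch X p' = Halt"
  shows "exec X p \<sigma> \<tau>"
  using assms(1)
proof (induction N arbitrary: p \<sigma>)
  case 0
  \<comment> \<open>The default instruction of \<open>fetch\<close> is not \<open>Halt\<close>, so
    \<open>p'\<close> is a position in \<open>X\<close>.\<close>
  with assms(2) show ?case
    by (auto simp: fetch_def intro: exec_Halt split: if_splits)
next
  case (Suc N)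
  obtain p1 \<sigma>1 where "cstep X (p, \<sigma>) = (p1, \<sigma>1)" by fastforce
  with Suc exec_if_cstep show ?case
    by (metis comp_apply funpow_Suc_right)
qed

text \<open>A step forward lowers \<open>length X - p\<close>, the number of steps still needed.
  \<open>Q\<close> is a parameter, so that one argument serves every instruction other than
  \<open>Halt\<close>.\<close>

lemma funpow_cstep_Suc:
  assumes "length X - p \<le> N" "p < length X" "cstep X (p, \<sigma>) = (p', \<sigma>')" "p < p'"
    and "\<And>N. length X - p' \<le> N \<Longrightarrow> Q ((cstep X ^^ N) (p', \<sigma>'))"
  shows "Q ((cstep X ^^ N) (p, \<sigma>))"
proof -
  obtain N' where "N = Suc N'" "length X - p' \<le> N'"
    using assms(1,2,4) by (cases N) auto
  with assms(3,5) show ?thesis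
    by (simp add: funpow_Suc_right del: funpow.simps cstep.simps)
qed

text \<open>Each step of \<open>exec\<close> moves strictly forward, and surplus steps idle at
  \<open>Halt\<close>.\<close>

lemma funpow_cstep_if_exec:
  assumes "exec X p \<sigma> \<tau>" "length X - p \<le> N"
  shows "fetch X (fst ((cstep X ^^ N) (p, \<sigma>))) = Halt \<and> snd ((cstep X ^^ N) (p, \<sigma>)) = \<tau>"
  using assms
proof (induction arbitrary: N rule: exec.induct)
  case (exec_Plain p a \<sigma> b \<sigma>' \<tau>)
  show ?case
    by (rule funpow_cstep_Suc[where Q = "\<lambda>c. fetch X (fst c) = Halt \<and> snd c = \<tau>",
          OF exec_Plain.prems exec_Plain.hyps(1) _ _ exec_Plain.IH])
      (use exec_Plain.hyps in \<open>simp_all add: fetch_def\<close>)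
next
  case (exec_Pos p a \<sigma> b \<sigma>' \<tau>)
  show ?case
    by (rule funpow_cstep_Suc[where Q = "\<lambda>c. fetch X (fst c) = Halt \<and> snd c = \<tau>",
          OF exec_Pos.prems exec_Pos.hyps(1) _ _ exec_Pos.IH])
      (use exec_Pos.hyps in \<open>simp_all add: fetch_def\<close>)
next
  case (exec_Neg p a \<sigma> b \<sigma>' \<tau>)
  show ?case
    by (rule funpow_cstep_Suc[where Q = "\<lambda>c. fetch X (fst c) = Halt \<and> snd c = \<tau>",
          OF exec_Neg.prems exec_Neg.hyps(1) _ _ exec_Neg.IH])
      (use exec_Neg.hyps in \<open>simp_all add: fetch_def\<close>)
next
  case (exec_Jump p l \<sigma> \<tau>)
  show ?case
    by (rule funpow_cstep_Suc[where Q = "\<lambda>c. fetch X (fst c) = Halt \<and> snd c = \<tau>",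
          OF exec_Jump.prems exec_Jump.hyps(1) _ _ exec_Jump.IH])
      (use exec_Jump.hyps in \<open>simp_all add: fetch_def\<close>)
next
  case (exec_Halt p \<sigma>)
  have "(cstep X ^^ N) (p, \<sigma>) = (p, \<sigma>)"
    using exec_Halt.hyps by (induction N) (simp_all add: fetch_def)
  with exec_Halt show ?case by (simp add: fetch_def)
qed

section \<open>Monotonicity in the registers present, and reduction of \<open>computes\<close> to
  finitely many runs\<close>

lemma exec_basic_mono:
  assumes "exec_basic a \<sigma> = Some (b, \<sigma>')" "\<forall>r\<in>R \<inter> dom \<sigma>. \<rho> r = \<sigma> r" "basic_reg a \<in> R"
  shows "\<exists>\<rho>'. exec_basic a \<rho> = Some (b, \<rho>') \<and> (\<forall>r\<in>R \<inter> dom \<sigma>'. \<rho>' r = \<sigma>' r)"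
proof -
  have "basic_reg a \<in> dom \<sigma>"
    using assms(1) by (cases a) (auto simp: get_reg_def set_reg_def split: option.splits)
  then have "\<rho> (basic_reg a) = \<sigma> (basic_reg a)"
    using assms(2,3) by blast
  moreover have "\<rho> r = Some c" if "r \<in> R" "\<sigma> r = Some c" for r c
    using assms(2) that by (metis IntI domI)
  ultimately show ?thesis
    using assms(1) by (cases a) (auto simp: get_reg_def set_reg_def split: option.splits)
qed

text \<open>A terminating execution accesses only registers that are present, so adding registers
  cannot disturb it. The restriction to \<open>R\<close> lets registers that \<open>X\<close> does
  not mention differ, as they may in an arbitrary initial state.\<close>

lemma exec_mono:
  assumes "exec X p \<sigma> \<tau>" "\<forall>r\<in>R \<inter> dom \<sigma>. \<rho> r = \<sigma> r" "regs X \<subseteq> R"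
  shows "\<exists>\<tau>'. exec X p \<rho> \<tau>' \<and> (\<forall>r\<in>R \<inter> dom \<tau>. \<tau>' r = \<tau> r)"
proof -
  have sub: "prim_regs (X ! p) \<subseteq> R" if "p < length X" for p
    using that assms(3) nth_mem by (fastforce simp: regs_def)
  show ?thesis
    using assms(1,2)
  proof (induction arbitrary: \<rho> rule: exec.induct)
    case (exec_Plain p a \<sigma> b \<sigma>' \<tau>)
    then obtain \<rho>' where \<rho>': "exec_basic a \<rho> = Some (b, \<rho>')" "\<forall>r\<in>R \<inter> dom \<sigma>'. \<rho>' r = \<sigma>' r"
      using sub[of p] exec_basic_mono[of a \<sigma> b \<sigma>' R \<rho>] by auto
    from exec_Plain.IH[OF \<rho>'(2)] show ?case
      using exec.exec_Plain[OF exec_Plain.hyps(1,2) \<rho>'(1)] by blast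
  next
    case (exec_Pos p a \<sigma> b \<sigma>' \<tau>)
    then obtain \<rho>' where \<rho>': "exec_basic a \<rho> = Some (b, \<rho>')" "\<forall>r\<in>R \<inter> dom \<sigma>'. \<rho>' r = \<sigma>' r"
      using sub[of p] exec_basic_mono[of a \<sigma> b \<sigma>' R \<rho>] by auto
    from exec_Pos.IH[OF \<rho>'(2)] show ?case
      using exec.exec_Pos[OF exec_Pos.hyps(1,2) \<rho>'(1)] by blast
  next
    case (exec_Neg p a \<sigma> b \<sigma>' \<tau>)
    then obtain \<rho>' where \<rho>': "exec_basic a \<rho> = Some (b, \<rho>')" "\<forall>r\<in>R \<inter> dom \<sigma>'. \<rho>' r = \<sigma>' r"
      using sub[of p] exec_basic_mono[of a \<sigma> b \<sigma>' R \<rho>] by auto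
    from exec_Neg.IH[OF \<rho>'(2)] show ?case
      using exec.exec_Neg[OF exec_Neg.hyps(1,2) \<rho>'(1)] by blast
  next
    case (exec_Jump p l \<sigma> \<tau>)
    then show ?case by (metis exec.exec_Jump)
  next
    case (exec_Halt p \<sigma>)
    then show ?case by (metis exec.exec_Halt)
  qed
qed

text \<open>Auxiliary registers of all indices are present, which makes this one state initial for
  every \<open>k\<close>, whatever witness \<open>computes\<close> provides.\<close>

definition input_state :: "bool list \<Rightarrow> state" where
  "input_state bs r = (case r of
     In i \<Rightarrow> if 1 \<le> i \<and> i \<le> length bs then Some (bs ! (i - 1)) else None
   | Out \<Rightarrow> Some False | Aux i \<Rightarrow> Some False)"

definition accepts :: "prim list \<Rightarrow> bool list \<Rightarrow> bool" where
  "accepts X bs \<longleftrightarrow> (case (cstep X ^^ length X) (0, input_state bs) of (p, \<tau>) \<Rightarrow>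
     fetch X p = Halt \<and> \<tau> Out = Some (tstnz bs))"

lemma accepts_iff_exec:
  "accepts X bs \<longleftrightarrow> (\<exists>\<tau>. exec X 0 (input_state bs) \<tau> \<and> \<tau> Out = Some (tstnz bs))"
  using exec_if_funpow_cstep funpow_cstep_if_exec[of X 0 "input_state bs" _ "length X"]
  unfolding accepts_def by (fastforce split: prod.splits)

lemma computes_iff_accepts:
  assumes "X \<in> IS"
  shows "computes n X tstnz \<longleftrightarrow> (\<forall>bs. length bs = n \<longrightarrow> accepts X bs)"
proof
  assume "computes n X tstnz"
  moreover have "initial_state bs k (input_state bs)" for bs k
    by (auto simp: initial_state_def input_state_def)
  ultimately show "\<forall>bs. length bs = n \<longrightarrow> accepts X bs"
    unfolding computes_def accepts_iff_exec by blast
next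
  assume acc: "\<forall>bs. length bs = n \<longrightarrow> accepts X bs"
  have "finite (Aux -` regs X)"
    by (rule finite_vimageI[OF finite_regs]) (simp add: inj_def)
  \<comment> \<open>Only the auxiliary registers occurring in \<open>X\<close> have to start at 0;
    there are finitely many, so a bound on their indices serves as witness.\<close>
  then obtain k where k: "\<And>i. Aux i \<in> regs X \<Longrightarrow> i \<le> k"
    using finite_nat_set_iff_bounded_le by (metis vimageI)
  show "computes n X tstnz"
    unfolding computes_def
  proof (intro exI[of _ k] allI impI)
    fix bs \<sigma>
    assume "length bs = n" and init: "initial_state bs k \<sigma>"
    then obtain \<tau> where \<tau>: "exec X 0 (input_state bs) \<tau>" "\<tau> Out = Some (tstnz bs)"
      using acc accepts_iff_exec by blast
    have agree: "\<forall>r \<in> insert Out (regs X) \<inter> dom (input_state bs). \<sigma> r = input_state bs r"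
    proof
      fix r
      assume r: "r \<in> insert Out (regs X) \<inter> dom (input_state bs)"
      show "\<sigma> r = input_state bs r"
      proof (cases r)
        case (In i)
        with r init show ?thesis
          by (auto simp: initial_state_def input_state_def split: if_splits)
      next
        case Out
        with init show ?thesis by (simp add: initial_state_def input_state_def)
      next
        case (Aux i)
        \<comment> \<open>\<open>IS\<close> excludes \<open>Aux 0\<close>, about which
          \<open>initial_state\<close> says nothing.\<close>
        with r have "i \<in> {1..k}" using k[of i] IS_regs[OF assms, of i] by auto
        with Aux init show ?thesis by (simp add: initial_state_def input_state_def)
      qed
    qed
    obtain \<tau>' where "exec X 0 \<sigma> \<tau>'" "\<forall>r \<in> insert Out (regs X) \<inter> dom \<tau>. \<tau>' r = \<tau> r"
      using exec_mono[OF \<tau>(1) agree subset_insertI] by blast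
    moreover have "Out \<in> insert Out (regs X) \<inter> dom \<tau>"
      using \<tau>(2) by blast
    ultimately show "\<exists>\<tau>. exec X 0 \<sigma> \<tau> \<and> \<tau> Out = Some (tstnz bs)"
      using \<tau>(2) by metis
  qed
qed

section \<open>Bit vectors as numbers\<close>

fun val :: "bool list \<Rightarrow> nat" where
  "val [] = 0"
| "val (b # bs) = (if b then 2 ^ length bs else 0) + val bs"

fun bits :: "nat \<Rightarrow> nat \<Rightarrow> bool list" where
  "bits 0 x = []"
| "bits (Suc n) x = (2 ^ n \<le> x) # bits n (if 2 ^ n \<le> x then x - 2 ^ n else x)"

lemma length_bits [simp]: "length (bits n x) = n"
  by (induction n arbitrary: x) auto

lemma val_less: "val bs < 2 ^ length bs"
  by (induction bs) auto

lemma val_bits: "x < 2 ^ n \<Longrightarrow> val (bits n x) = x"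
  by (induction n arbitrary: x) auto

lemma bits_val: "bits (length bs) (val bs) = bs"
proof (induction bs)
  case (Cons b bs)
  with val_less[of bs] show ?case by auto
qed simp

text \<open>Turns the expected output into a sign test on the number of the vector, without another
  pass over its bits.\<close>

lemma tstnz_iff_val: "tstnz bs \<longleftrightarrow> 0 < val bs"
  unfolding tstnz_def by (induction bs) auto

lemma all_bits_iff: "(\<forall>x < 2 ^ n. Q (bits n x)) \<longleftrightarrow> (\<forall>bs. length bs = n \<longrightarrow> Q bs)"
  by (metis bits_val length_bits val_less)

section \<open>The RAM program\<close>

definition form :: "prim \<Rightarrow> int" where
  "form u = encode_prim u ! 0"

definition param :: "prim \<Rightarrow> int" where
  "param u = encode_prim u ! 1"

lemma form_simps [simp]:
  "form (Plain a) = basic_form a" "form (Pos a) = 6 + basic_form a" "form (Neg a) = 12 + basic_form a"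
  "form (Jump l) = 18" "form Halt = 19"
  by (simp_all add: form_def)

lemma param_simps [simp]:
  "param (Plain a) = basic_param a" "param (Pos a) = basic_param a" "param (Neg a) = basic_param a"
  "param (Jump l) = int l" "param Halt = - 1"
  by (simp_all add: param_def)

lemma encode_prim_eq: "encode_prim u = [form u, param u]"
  by (cases u) simp_all

text \<open>Absence is coded as 0, the content of untouched RAM cells, so only the inputs 1 to
  \<open>n\<close> ever have to be written. The same codes serve as replies.\<close>

fun input_cell :: "bool option \<Rightarrow> int" where
  "input_cell None = 0"
| "input_cell (Some b) = (if b then 2 else 1)"

text \<open>Only \<open>v = x + 1\<close> means true; smaller values are stamps of earlier vectors
  or cleared cells. The upper bound ensures that no content comes to mean true when \<open>x\<close>
  is incremented.\<close>

definition stamped :: "nat \<Rightarrow> bool option \<Rightarrow> int \<Rightarrow> bool" where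
  "stamped x c v \<longleftrightarrow> v \<le> int x + 1 \<and> c = Some (int x < v)"

text \<open>
  Cells 0 to 15 are working registers. From cell 16 on, four arrays are interleaved: forms
  (\<open>16 + 4p\<close>), parameters (\<open>17 + 4p\<close>), inputs (\<open>22 + 4i\<close>) and auxiliary registers (\<open>23 + 4i\<close>). The output
  register is the auxiliary register with index \<open>-1\<close>, because \<open>-1\<close> is the parameter of its
  instructions. \<open>x\<close> is the number of the current input vector; a set register contains the stamp
  \<open>x + 1\<close>, so that everything is reset when \<open>x\<close> is incremented.
\<close>

definition represents :: "prim list \<Rightarrow> nat \<Rightarrow> state \<Rightarrow> (nat \<Rightarrow> int) \<Rightarrow> bool" where
  "represents X x \<sigma> m \<longleftrightarrow> m 2 = int x \<and> stamped x (\<sigma> Out) (m 19) \<and>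
     (\<forall>p. m (16 + 4 * p) = form (fetch X p) \<and> m (17 + 4 * p) = param (fetch X p) \<and>
        m (22 + 4 * p) = input_cell (\<sigma> (In p)) \<and> stamped x (\<sigma> (Aux p)) (m (23 + 4 * p)))"

text \<open>The bases 16, 17, 22 and 23 of the four arrays have different residues modulo 4, so
  their cells never coincide. The inequations appear with the common part of the addresses
  cancelled.\<close>

lemma cell_neq [simp]:
  fixes i p :: nat
  shows "4 * p \<noteq> Suc (4 * i)" "4 * p \<noteq> 2 + 4 * i" "4 * p \<noteq> 3 + 4 * i"
    "4 * p \<noteq> 5 + 4 * i" "4 * p \<noteq> 6 + 4 * i" "4 * p \<noteq> 7 + 4 * i"
    "Suc (4 * i) \<noteq> 4 * p" "2 + 4 * i \<noteq> 4 * p" "3 + 4 * i \<noteq> 4 * p"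
    "5 + 4 * i \<noteq> 4 * p" "6 + 4 * i \<noteq> 4 * p" "7 + 4 * i \<noteq> 4 * p"
    "4 * p \<noteq> 2" "4 * p \<noteq> 3" "2 \<noteq> 4 * p" "3 \<noteq> 4 * p"
  by presburger+

lemma represents_frame [simp]:
  "r < 16 \<Longrightarrow> r \<noteq> 2 \<Longrightarrow> represents X x \<sigma> (m(r := v)) \<longleftrightarrow> represents X x \<sigma> m"
  by (auto simp: represents_def)

lemma represents_set_Out:
  assumes "represents X x \<sigma> m" "stamped x (Some b) v"
  shows "represents X x (\<sigma>(Out \<mapsto> b)) (m(19 := v))"
  using assms by (simp add: represents_def)

lemma represents_set_Aux:
  assumes "represents X x \<sigma> m" "stamped x (Some b) v"
  shows "represents X x (\<sigma>(Aux i \<mapsto> b)) (m(23 + 4 * i := v))"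
  using assms by (simp add: represents_def)

lemma nat_cell [simp]: "nat (numeral u + 4 * int k) = numeral u + 4 * k"
  by (simp add: nat_add_distrib nat_mult_distrib)

section \<open>One simulated instruction: decoding, register access, choice of the successor\<close>

text \<open>
  Registers: 1 address of the current instruction, 2 \<open>x\<close>, 3 loop counter, 4 \<open>n\<close>, 5 \<open>length X\<close>,
  6 \<open>2 ^ n\<close>, 7 verdict, 8 form, 9 parameter, 10 distance to the next instruction, 11 address of
  the accessed cell, 12 basic instruction, 13 its mode (plain, positive or negative test),
  14 reply (0: absent, 1: false, 2: true).
\<close>

definition decode_com :: com where
  "decode_com =
     Atom (Const 11 1) ;; Atom (Const 13 0) ;; Atom (Const 15 6) ;; Atom (Add 12 8 13) ;;
     IfGe 12 6 (Atom (Sub 12 12 15) ;; Atom (Add 13 13 11)) ;;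
     IfGe 12 6 (Atom (Sub 12 12 15) ;; Atom (Add 13 13 11))"

text \<open>\<open>23 + 4 * param\<close> is the cell of an auxiliary register and, for parameter
  -1, that of the output register; one less gives the input cell. Subtracting 3 aligns the auxiliary
  \<open>set\<close> forms with the output forms. The reply is read back after a possible write, so
  \<open>get\<close> and \<open>set\<close> share that code.\<close>

definition access_com :: com where
  "access_com =
     Atom (Const 14 0) ;; Atom (Const 11 23) ;;
     Atom (Add 9 9 9) ;; Atom (Add 9 9 9) ;; Atom (Add 11 11 9) ;;
     IfLe 12 0 (Atom (Const 0 1) ;; Atom (Sub 11 11 0) ;; Atom (Load 14 11)) ;;
     IfGe 12 1 (
       IfGe 12 3 (Atom (Const 0 3) ;; Atom (Sub 12 12 0)) ;;
       IfGe 12 1 (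
         Atom (Const 15 0) ;;
         IfGe 12 2 (Atom (Const 0 1) ;; Atom (Add 15 2 0)) ;;
         Atom (Store 11 15)) ;;
       Atom (Load 15 11) ;; Atom (Sub 15 15 2) ;;
       Atom (Const 14 1) ;; IfGe 15 1 (Atom (Const 14 2)))"

text \<open>With replies coded as 1 and 2, the distance is \<open>3 - reply\<close> for a positive
  test and \<open>reply\<close> itself for a negative one. Reply 0 leaves the distance at 0, which
  keeps a stuck execution in place.\<close>

definition branch_com :: com where
  "branch_com = IfGe 14 1 (
     Atom (Const 10 1) ;;
     IfGe 13 1 (
       Atom (Const 10 3) ;; Atom (Sub 10 10 14) ;;
       IfGe 13 2 (Atom (Sub 10 10 10) ;; Atom (Add 10 10 14))))"

text \<open>Distance 0 covers \<open>Halt\<close>, \<open>Jump 0\<close> and absent registers alike.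
  The two doublings are there because instructions lie 4 cells apart.\<close>

definition step_com :: com where
  "step_com =
     Atom (Load 8 1) ;; Atom (Const 0 1) ;; Atom (Add 9 1 0) ;; Atom (Load 9 9) ;;
     Atom (Const 10 0) ;;
     IfLe 8 17 (decode_com ;; access_com ;; branch_com) ;;
     IfGe 8 18 (IfLe 8 18 (Atom (Add 10 10 9))) ;;
     Atom (Add 10 10 10) ;; Atom (Add 10 10 10) ;; Atom (Add 1 1 10)"

lemma basic_form_bounds: "0 \<le> basic_form a" "basic_form a \<le> 5"
  by (cases a; simp)+

text \<open>The form is 6 times the mode \<open>k\<close> plus the basic form, so two conditional
  subtractions of 6 replace a division. Writing \<open>fst s r\<close> back to cell \<open>r\<close>
  in the postcondition leaves the scratch cells unspecified.\<close>

lemma wp_decode: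
  assumes "m 8 = 6 * int k + basic_form a" "k \<le> 2"
  shows "wp decode_com (\<lambda>s. s = (m(0 := fst s 0, 11 := fst s 11, 12 := basic_form a,
    13 := int k, 15 := fst s 15), xs, ys)) (m, xs, ys)"
proof -
  have "k = 0 \<or> k = 1 \<or> k = 2" using assms(2) by auto
  then show ?thesis
    using assms(1) basic_form_bounds[of a] by (auto simp: decode_com_def fun_eq_iff)
qed

lemma wp_access:
  assumes rep: "represents X x \<sigma> m" and "m 12 = basic_form a" "m 9 = basic_param a"
  shows "wp access_com (\<lambda>(m', xs', ys'). xs' = xs \<and> ys' = ys \<and>
    (\<forall>r \<in> {1..8} \<union> {10, 13}. m' r = m r) \<and>
    (case exec_basic a \<sigma> of None \<Rightarrow> m' 14 = 0 \<and> represents X x \<sigma> m'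
     | Some (b, \<sigma>') \<Rightarrow> m' 14 = (if b then 2 else 1) \<and> represents X x \<sigma>' m')) (m, xs, ys)"
proof -
  have cells: "m 2 = int x" "stamped x (\<sigma> Out) (m 19)" "m (22 + 4 * i) = input_cell (\<sigma> (In i))"
    "stamped x (\<sigma> (Aux i)) (m (23 + 4 * i))" for i
    using rep by (simp_all add: represents_def)
  show ?thesis
  proof (cases a)
    case (InGet i)
    with assms cells(1) cells(3)[of i] show ?thesis
      by (simp add: access_com_def get_reg_def split: option.split)
  next
    case (OutSet b)
    with assms cells(1,2) show ?thesis
      by (cases b) (auto simp: access_com_def set_reg_def stamped_def intro!: represents_set_Out)
  next
    case (AuxGet i)
    with assms cells(1) cells(4)[of i] show ?thesis
      by (auto simp: access_com_def get_reg_def stamped_def)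
  next
    case (AuxSet i b)
    with assms cells(1) cells(4)[of i] show ?thesis
      by (cases b) (auto simp: access_com_def set_reg_def stamped_def intro!: represents_set_Aux)
  qed
qed

lemma wp_branch:
  assumes "m 13 = int k" "k \<le> 2" "m 10 = 0" "m 14 = v" "v = 0 \<or> v = 1 \<or> v = 2"
  shows "wp branch_com (\<lambda>s. s = (m(0 := fst s 0, 10 := (if v = 0 then 0 else if k = 0 then 1
    else if k = 1 then 3 - v else v)), xs, ys)) (m, xs, ys)"
proof -
  have "k = 0 \<or> k = 1 \<or> k = 2" using assms(2) by auto
  then show ?thesis
    using assms(1,3-5) by (auto simp: branch_com_def fun_eq_iff)
qed

lemma wp_basic:
  assumes "represents X x \<sigma> m" "m 8 = 6 * int k + basic_form a" "k \<le> 2"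
    "m 9 = basic_param a" "m 10 = 0"
  shows "wp (decode_com ;; access_com ;; branch_com) (\<lambda>(m', xs', ys'). xs' = xs \<and> ys' = ys \<and>
    (\<forall>r \<in> {1..8}. m' r = m r) \<and>
    (case exec_basic a \<sigma> of None \<Rightarrow> m' 10 = 0 \<and> represents X x \<sigma> m'
     | Some (b, \<sigma>') \<Rightarrow> m' 10 = (if k = 0 then 1 else if b = (k = 1) then 1 else 2) \<and>
         represents X x \<sigma>' m')) (m, xs, ys)"
  unfolding wp.simps(2)
proof (rule wp_mono[OF wp_decode[of m k a, OF assms(2,3)]])
  fix s
  assume "s = (m(0 := fst s 0, 11 := fst s 11, 12 := basic_form a, 13 := int k,
    15 := fst s 15), xs, ys)"
  then obtain m1 where s: "s = (m1, xs, ys)" and m1: "m1 = m(0 := m1 0, 11 := m1 11,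
      12 := basic_form a, 13 := int k, 15 := m1 15)"
    by (metis fst_conv)
  have r1: "m1 r = m r" if "r \<notin> {0, 11, 12, 13, 15}" for r
    using that by (subst m1) simp
  have "represents X x \<sigma> m1" using assms(1) by (subst m1) simp
  moreover have m1_12: "m1 12 = basic_form a" and m1_13: "m1 13 = int k"
    by (subst m1, simp)+
  moreover have "m1 9 = basic_param a" using assms(4) r1[of 9] by simp
  ultimately have "wp access_com (\<lambda>(m', xs', ys'). xs' = xs \<and> ys' = ys \<and>
    (\<forall>r \<in> {1..8} \<union> {10, 13}. m' r = m1 r) \<and>
    (case exec_basic a \<sigma> of None \<Rightarrow> m' 14 = 0 \<and> represents X x \<sigma> m'
     | Some (b, \<sigma>') \<Rightarrow> m' 14 = (if b then 2 else 1) \<and> represents X x \<sigma>' m')) s"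
    unfolding s using wp_access by blast
  then show "wp access_com (wp branch_com (\<lambda>(m', xs', ys'). xs' = xs \<and> ys' = ys \<and>
    (\<forall>r \<in> {1..8}. m' r = m r) \<and>
    (case exec_basic a \<sigma> of None \<Rightarrow> m' 10 = 0 \<and> represents X x \<sigma> m'
     | Some (b, \<sigma>') \<Rightarrow> m' 10 = (if k = 0 then 1 else if b = (k = 1) then 1 else 2) \<and>
         represents X x \<sigma>' m'))) s"
  proof (rule wp_mono, clarify)
    fix m2
    assume r2: "\<forall>r \<in> {1..8} \<union> {10, 13}. m2 r = m1 r"
      and acc: "case exec_basic a \<sigma> of None \<Rightarrow> m2 14 = 0 \<and> represents X x \<sigma> m2
        | Some (b, \<sigma>') \<Rightarrow> m2 14 = (if b then 2 else 1) \<and> represents X x \<sigma>' m2"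
    have "m2 13 = int k" "m2 10 = 0" using r2 m1_13 r1[of 10] assms(5) by auto
    moreover have "m2 14 = 0 \<or> m2 14 = 1 \<or> m2 14 = 2"
      using acc by (auto split: option.splits if_splits)
    ultimately show "wp branch_com (\<lambda>(m', xs', ys'). xs' = xs \<and> ys' = ys \<and>
      (\<forall>r \<in> {1..8}. m' r = m r) \<and>
      (case exec_basic a \<sigma> of None \<Rightarrow> m' 10 = 0 \<and> represents X x \<sigma> m'
       | Some (b, \<sigma>') \<Rightarrow> m' 10 = (if k = 0 then 1 else if b = (k = 1) then 1 else 2) \<and>
           represents X x \<sigma>' m')) (m2, xs, ys)"
    proof (rule wp_mono[OF wp_branch[of m2 k, OF _ assms(3) _ refl]])
      fix s'
      assume s': "s' = (m2(0 := fst s' 0, 10 := if m2 14 = 0 then 0 else if k = 0 then 1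
        else if k = 1 then 3 - m2 14 else m2 14), xs, ys)"
      have "\<forall>r \<in> {1..8}. m2 r = m r" using r1 r2 by auto
      then show "case s' of (m', xs', ys') \<Rightarrow> xs' = xs \<and> ys' = ys \<and>
        (\<forall>r \<in> {1..8}. m' r = m r) \<and>
        (case exec_basic a \<sigma> of None \<Rightarrow> m' 10 = 0 \<and> represents X x \<sigma> m'
         | Some (b, \<sigma>') \<Rightarrow> m' 10 = (if k = 0 then 1 else if b = (k = 1) then 1 else 2) \<and>
             represents X x \<sigma>' m')"
        using acc assms(3) by (subst s') (auto split: option.splits)
    qed
  qed
qed

text \<open>Treats the three modes at once: for a test, \<open>b = (k = 1)\<close> says that the
  reply agrees with its sign.\<close>

lemma wp_step_basic:
  assumes rep: "represents X x \<sigma> m" and pos: "m 1 = int (16 + 4 * p)" and k: "k \<le> 2"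
    and fetch: "form (fetch X p) = 6 * int k + basic_form a" "param (fetch X p) = basic_param a"
    and next_conf: "(p', \<sigma>') = (case exec_basic a \<sigma> of None \<Rightarrow> (p, \<sigma>)
      | Some (b, \<sigma>'') \<Rightarrow> (p + (if k = 0 then 1 else if b = (k = 1) then 1 else 2), \<sigma>''))"
  shows "wp step_com (\<lambda>(m', xs', ys'). xs' = xs \<and> ys' = ys \<and> m' 1 = int (16 + 4 * p') \<and>
    represents X x \<sigma>' m' \<and> (\<forall>r \<in> {3..7}. m' r = m r)) (m, xs, ys)"
proof -
  have cells: "m (16 + 4 * p) = 6 * int k + basic_form a" "m (17 + 4 * p) = basic_param a"
    using rep fetch by (simp_all add: represents_def)
  define m1 where "m1 = m(8 := 6 * int k + basic_form a, 9 := basic_param a, 10 := 0,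
    0 := 6 * int k + basic_form a - 17)"
  have bound: "6 * int k + basic_form a \<le> 17"
    using k basic_form_bounds[of a] by auto
  have m1: "m1 8 = 6 * int k + basic_form a" "m1 9 = basic_param a" "m1 10 = 0"
    "represents X x \<sigma> m1"
    using rep by (simp_all add: m1_def)
  have "wp (decode_com ;; access_com ;; branch_com)
    (wp (IfGe 8 18 (IfLe 8 18 (Atom (Add 10 10 9))) ;;
     Atom (Add 10 10 10) ;; Atom (Add 10 10 10) ;; Atom (Add 1 1 10)) (\<lambda>(m', xs', ys').
    xs' = xs \<and> ys' = ys \<and> m' 1 = int (16 + 4 * p') \<and>
    represents X x \<sigma>' m' \<and> (\<forall>r \<in> {3..7}. m' r = m r))) (m1, xs, ys)"
  proof (rule wp_mono[OF wp_basic[of X x \<sigma> m1 k a, OF m1(4,1) k m1(2,3)]], clarify)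
    fix m2
    assume r: "\<forall>r \<in> {1..8}. m2 r = m1 r"
      and res: "case exec_basic a \<sigma> of None \<Rightarrow> m2 10 = 0 \<and> represents X x \<sigma> m2
        | Some (b, \<sigma>') \<Rightarrow> m2 10 = (if k = 0 then 1 else if b = (k = 1) then 1 else 2) \<and>
           represents X x \<sigma>' m2"
    have small: "m2 8 < 18" "m2 1 = 16 + 4 * int p" "\<forall>r \<in> {3..7}. m2 r = m r"
      using r m1(1) bound pos by (auto simp: m1_def)
    show "wp (IfGe 8 18 (IfLe 8 18 (Atom (Add 10 10 9))) ;;
       Atom (Add 10 10 10) ;; Atom (Add 10 10 10) ;; Atom (Add 1 1 10)) (\<lambda>(m', xs', ys').
      xs' = xs \<and> ys' = ys \<and> m' 1 = int (16 + 4 * p') \<and>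
      represents X x \<sigma>' m' \<and> (\<forall>r \<in> {3..7}. m' r = m r)) (m2, xs, ys)"
      using small res next_conf by (auto split: option.splits if_splits)
  qed
  moreover have "m(8 := 6 * int k + basic_form a, 0 := 1, 9 := basic_param a, 10 := 0,
    0 := 6 * int k + basic_form a - 17) = m1"
    by (auto simp: m1_def)
  ultimately show ?thesis
    using bound pos cells by (simp add: step_com_def del: fun_upd_apply) (simp)
qed

lemma wp_step:
  assumes rep: "represents X x \<sigma> m" and pos: "m 1 = int (16 + 4 * p)"
    and step: "cstep X (p, \<sigma>) = (p', \<sigma>')"
  shows "wp step_com (\<lambda>(m', xs', ys'). xs' = xs \<and> ys' = ys \<and> m' 1 = int (16 + 4 * p') \<and>
    represents X x \<sigma>' m' \<and> (\<forall>r \<in> {3..7}. m' r = m r)) (m, xs, ys)"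
proof (cases "fetch X p")
  case (Plain a)
  with step show ?thesis
    by (intro wp_step_basic[of X x \<sigma> m p 0 a, OF rep pos]) (auto split: option.splits)
next
  case (Pos a)
  with step show ?thesis
    by (intro wp_step_basic[of X x \<sigma> m p 1 a, OF rep pos]) (auto split: option.splits)
next
  case (Neg a)
  with step show ?thesis
    by (intro wp_step_basic[of X x \<sigma> m p 2 a, OF rep pos]) (auto split: option.splits)
next
  case (Jump l)
  moreover have "m (16 + 4 * p) = form (fetch X p)" "m (17 + 4 * p) = param (fetch X p)"
    using rep by (simp_all add: represents_def)
  ultimately show ?thesis
    using step rep pos by (auto simp: step_com_def)
next
  case Halt
  moreover have "m (16 + 4 * p) = form (fetch X p)" "m (17 + 4 * p) = param (fetch X p)"
    using rep by (simp_all add: represents_def)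
  ultimately show ?thesis
    using step rep pos by (auto simp: step_com_def)
qed

section \<open>Running \<open>X\<close> on one input vector\<close>

definition simulate_com :: com where
  "simulate_com = (Atom (Const 1 16) ;; Atom (Const 0 0) ;; Atom (Add 3 5 0)) ;;
     Repeat (step_com ;; Atom (Const 0 1) ;; Atom (Sub 3 3 0)) 3"

lemma within_simulate:
  assumes rep: "represents X x \<sigma> m" and len: "m 5 = int (length X)" "0 < length X"
    and run: "(cstep X ^^ length X) (0, \<sigma>) = (p', \<sigma>')"
  shows "within (3 + length X * (clen step_com + 3)) simulate_com (\<lambda>(m', xs', ys').
    xs' = xs \<and> ys' = ys \<and> m' 1 = int (16 + 4 * p') \<and>
    represents X x \<sigma>' m' \<and> (\<forall>r \<in> {4..7}. m' r = m r)) (m, xs, ys)"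
proof -
  define J where "J = (\<lambda>i (m', xs', ys'). xs' = xs \<and> ys' = ys \<and>
    m' 1 = int (16 + 4 * fst ((cstep X ^^ i) (0, \<sigma>))) \<and>
    represents X x (snd ((cstep X ^^ i) (0, \<sigma>))) m' \<and>
    m' 3 = int (length X) - int i \<and> (\<forall>r \<in> {4..7}. m' r = m r))"
  \<comment> \<open>The 2 stands for decrementing the counter, \<open>Suc\<close> for the closing
    \<open>Tra\<close>.\<close>
  have "within (length X * Suc (clen step_com + 2))
      (Repeat (step_com ;; Atom (Const 0 1) ;; Atom (Sub 3 3 0)) 3) (J (length X))
      (m(1 := 16, 0 := 0, 3 := int (length X)), xs, ys)"
  proof (rule within_Repeat)
    fix i s
    assume "i < length X" "J i s"
    obtain m1 where s: "s = (m1, xs, ys)"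
      and J: "m1 1 = int (16 + 4 * fst ((cstep X ^^ i) (0, \<sigma>)))"
        "represents X x (snd ((cstep X ^^ i) (0, \<sigma>))) m1"
        "m1 3 = int (length X) - int i" "\<forall>r \<in> {4..7}. m1 r = m r"
      using \<open>J i s\<close> by (cases s) (auto simp: J_def)
    obtain p0 \<sigma>0 q \<rho> where c: "(cstep X ^^ i) (0, \<sigma>) = (p0, \<sigma>0)" and q: "cstep X (p0, \<sigma>0) = (q, \<rho>)"
      by (metis surj_pair)
    have "wp step_com (\<lambda>(m', xs', ys'). xs' = xs \<and> ys' = ys \<and> m' 1 = int (16 + 4 * q) \<and>
      represents X x \<rho> m' \<and> (\<forall>r \<in> {3..7}. m' r = m1 r)) s"
      unfolding s using J(1,2) c q by (intro wp_step) simp_all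
    then have "wp step_com (wp (Atom (Const 0 1) ;; Atom (Sub 3 3 0))
      (\<lambda>s'. J (Suc i) s' \<and> (0 < fst s' 3 \<longleftrightarrow> Suc i < length X))) s"
      by (rule wp_mono) (use J(3,4) c q in \<open>auto simp: J_def simp del: cstep.simps\<close>)
    then show "within (clen step_com + 2) (step_com ;; Atom (Const 0 1) ;; Atom (Sub 3 3 0))
      (\<lambda>s'. J (Suc i) s' \<and> (0 < fst s' 3 \<longleftrightarrow> Suc i < length X)) s"
      using wp_imp_within[of "step_com ;; Atom (Const 0 1) ;; Atom (Sub 3 3 0)"] by simp
  next
    show "J 0 (m(1 := 16, 0 := 0, 3 := int (length X)), xs, ys)"
      using rep len(1) by (simp add: J_def)
  qed (use len in simp)
  then have "within (3 + length X * Suc (clen step_com + 2)) simulate_com (J (length X)) (m, xs, ys)"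
    unfolding simulate_com_def
    by (intro within_wp_Seq[of _ "length X * Suc (clen step_com + 2)"]) (use len(1) in simp_all)
  then show ?thesis
    by (rule within_mono) (auto simp: J_def run algebra_simps)
qed

text \<open>
  The bits of \<open>x\<close> come out most significant first: double, compare with \<open>2 ^ n\<close>, subtract.
\<close>

definition load_com :: com where
  "load_com = (Atom (Const 8 4) ;; Atom (Const 9 1) ;; Atom (Const 10 0) ;; Atom (Const 11 26) ;;
       Atom (Add 15 2 10) ;; Atom (Add 3 4 10)) ;;
     Repeat (Atom (Add 15 15 15) ;; Atom (Const 14 1) ;; Atom (Sub 0 6 15) ;;
       Unless 0 (Atom (Sub 15 15 6) ;; Atom (Const 14 2)) ;;
       Atom (Store 11 14) ;; Atom (Add 11 11 8) ;; Atom (Sub 3 3 9)) 3"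

lemma represents_set_In:
  assumes "represents X x \<sigma> m"
  shows "represents X x (\<sigma>(In i \<mapsto> b)) (m(22 + 4 * i := if b then 2 else 1))"
  using assms by (simp add: represents_def)

lemma within_load:
  assumes rep: "represents X (val bs) \<sigma> m"
    and agree: "\<And>r. r \<notin> In ` {1..length bs} \<Longrightarrow> \<sigma> r = input_state bs r"
    and regs: "m 4 = int (length bs)" "m 6 = 2 ^ length bs" and "bs \<noteq> []"
  shows "within (6 + length bs * 10) load_com (\<lambda>(m', xs', ys').
    xs' = xs \<and> ys' = ys \<and> represents X (val bs) (input_state bs) m' \<and>
    (\<forall>r \<in> {4..7}. m' r = m r)) (m, xs, ys)"
proof -
  let ?n = "length bs"
  \<comment> \<open>Register 15 holds \<open>x\<close> without its \<open>k\<close> leading bits,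
    shifted left by \<open>k\<close> places. The address is \<open>22 + 4 * (k + 1)\<close>, inputs
    being counted from 1. Inputs not yet loaded may stem from the previous vector, hence the partly
    unspecified \<open>\<rho>\<close>.\<close>
  define J where "J = (\<lambda>k (m', xs', ys'). xs' = xs \<and> ys' = ys \<and>
    m' 8 = 4 \<and> m' 9 = 1 \<and> m' 11 = int (26 + 4 * k) \<and> m' 3 = int ?n - int k \<and>
    m' 15 = 2 ^ k * int (val (drop k bs)) \<and> (\<forall>r \<in> {4..7}. m' r = m r) \<and>
    (\<exists>\<rho>. represents X (val bs) \<rho> m' \<and>
      (\<forall>r. r \<notin> In ` {Suc k..?n} \<longrightarrow> \<rho> r = input_state bs r)))"
  let ?body = "Atom (Add 15 15 15) ;; Atom (Const 14 1) ;; Atom (Sub 0 6 15) ;;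
       Unless 0 (Atom (Sub 15 15 6) ;; Atom (Const 14 2)) ;;
       Atom (Store 11 14) ;; Atom (Add 11 11 8) ;; Atom (Sub 3 3 9)"
  have "within (?n * Suc 9) (Repeat ?body 3) (J ?n)
    (m(8 := 4, 9 := 1, 10 := 0, 11 := 26, 15 := int (val bs), 3 := int ?n), xs, ys)"
  proof (rule within_Repeat)
    fix k s
    assume k: "k < ?n" and "J k s"
    obtain m1 \<rho> where s: "s = (m1, xs, ys)"
      and J: "m1 8 = 4" "m1 9 = 1" "m1 11 = 26 + 4 * int k" "m1 3 = int ?n - int k"
        "m1 15 = 2 ^ k * int (val (drop k bs))" "\<forall>r \<in> {4..7}. m1 r = m r"
        "represents X (val bs) \<rho> m1"
        "\<And>r. r \<notin> In ` {Suc k..?n} \<Longrightarrow> \<rho> r = input_state bs r"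
      using \<open>J k s\<close> by (cases s) (auto simp: J_def)
    define b where "b = bs ! k"
    have val: "val (drop k bs) = (if b then 2 ^ (?n - Suc k) else 0) + val (drop (Suc k) bs)"
      by (subst Cons_nth_drop_Suc[OF k, symmetric]) (simp add: b_def)
    have less: "val (drop (Suc k) bs) < 2 ^ (?n - Suc k)"
      using val_less[of "drop (Suc k) bs"] by simp
    \<comment> \<open>After doubling, a leading 1 weighs exactly \<open>2 ^ ?n\<close> and the rest
      \<open>y\<close> stays below, so comparison with \<open>2 ^ ?n\<close> reveals the
      bit.\<close>
    have pow: "(2::int) * 2 ^ k * 2 ^ (?n - Suc k) = 2 ^ ?n"
      using k by (simp flip: power_add power_Suc)
    define y where "y = 2 * 2 ^ k * int (val (drop (Suc k) bs))"
    have "2 * 2 ^ k * int (val (drop (Suc k) bs)) < 2 * 2 ^ k * int (2 ^ (?n - Suc k))"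
      using less by (intro mult_strict_left_mono) (simp_all del: of_nat_power)
    then have y: "0 \<le> y" "y < 2 ^ ?n"
      using pow by (simp_all add: y_def)
    have double: "m1 15 + m1 15 = (if b then 2 ^ ?n else 0) + y"
      using J(5) val pow by (simp add: y_def algebra_simps)
    let ?\<rho>' = "\<rho>(In (Suc k) \<mapsto> b)"
    have rep': "represents X (val bs) ?\<rho>' (m1(26 + 4 * k := if b then 2 else 1))"
      using represents_set_In[OF J(7), of "Suc k" b] by simp
    have agree': "?\<rho>' r = input_state bs r" if "r \<notin> In ` {Suc (Suc k)..?n}" for r
    proof (cases "r = In (Suc k)")
      case True
      then show ?thesis using k by (simp add: input_state_def b_def)
    next
      case False
      have "r \<notin> In ` {Suc k..?n}"
      proof
        assume "r \<in> In ` {Suc k..?n}"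
        then obtain i where "r = In i" "Suc k \<le> i" "i \<le> ?n" by auto
        with False that show False by (cases "i = Suc k") auto
      qed
      with False J(8) show ?thesis by simp
    qed
    have m16: "m1 6 = 2 ^ ?n" using J(6) regs(2) by simp
    have state: "J (Suc k) (m', xs, ys) \<and> (0 < m' 3 \<longleftrightarrow> Suc k < ?n)"
      if "\<forall>r. r \<ge> 16 \<or> r = 2 \<longrightarrow> m' r = (m1(26 + 4 * k := if b then 2 else 1)) r"
        "\<forall>r \<in> {4..9}. m' r = m1 r" "m' 11 = 30 + 4 * int k" "m' 3 = int ?n - int k - 1" "m' 15 = y" for m'
    proof -
      have "represents X (val bs) ?\<rho>' m'"
        using rep' that(1) by (auto simp: represents_def)
      moreover have "\<forall>r \<in> {4..7}. m' r = m r"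
        using J(6) that(2) by simp
      moreover have "m' 8 = 4" "m' 9 = 1"
        using J(1,2) that(2) by simp_all
      moreover have "\<forall>r. r \<notin> In ` {Suc (Suc k)..?n} \<longrightarrow> ?\<rho>' r = input_state bs r"
        using agree' by blast
      ultimately have "J (Suc k) (m', xs, ys)"
        using that(3-5) unfolding J_def y_def by (simp del: fun_upd_apply) blast
      with that(4) show ?thesis by auto
    qed
    have "wp ?body (\<lambda>(m', xs', ys'). xs' = xs \<and> ys' = ys \<and>
      (\<forall>r. r \<ge> 16 \<or> r = 2 \<longrightarrow> m' r = (m1(26 + 4 * k := if b then 2 else 1)) r) \<and>
      (\<forall>r \<in> {4..9}. m' r = m1 r) \<and> m' 11 = 30 + 4 * int k \<and>
      m' 3 = int ?n - int k - 1 \<and> m' 15 = y) (m1, xs, ys)"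
      using y double m16 J(1-4) by (cases b) auto
    then have "wp ?body (\<lambda>s'. J (Suc k) s' \<and> (0 < fst s' 3 \<longleftrightarrow> Suc k < ?n)) (m1, xs, ys)"
      by (rule wp_mono) (use state in force)
    then show "within 9 ?body (\<lambda>s'. J (Suc k) s' \<and> (0 < fst s' 3 \<longleftrightarrow> Suc k < ?n)) s"
      unfolding s by (rule within_wp) simp
  next
    show "J 0 (m(8 := 4, 9 := 1, 10 := 0, 11 := 26, 15 := int (val bs), 3 := int ?n), xs, ys)"
      using rep agree by (auto simp: J_def)
  qed (use \<open>bs \<noteq> []\<close> in simp)
  moreover have "m 2 = int (val bs)" using rep by (simp add: represents_def)
  ultimately have "within (6 + ?n * Suc 9) load_com (J ?n) (m, xs, ys)"
    unfolding load_com_def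
    by (intro within_wp_Seq[of _ "?n * Suc 9"]) (use regs(1) in simp_all)
  then show ?thesis
  proof (rule within_mono)
    fix s
    assume "J ?n s"
    then obtain m' \<rho> where s: "s = (m', xs, ys)" "\<forall>r \<in> {4..7}. m' r = m r"
      "represents X (val bs) \<rho> m'" "\<forall>r. \<rho> r = input_state bs r"
      by (cases s) (auto simp: J_def)
    then have "\<rho> = input_state bs" by auto
    with s show "case s of (m', xs', ys') \<Rightarrow>
      xs' = xs \<and> ys' = ys \<and> represents X (val bs) (input_state bs) m' \<and>
      (\<forall>r \<in> {4..7}. m' r = m r)" by simp
  qed simp
qed

section \<open>Checking the result and moving on to the next vector\<close>

definition check_com :: com where
  "check_com = Atom (Const 15 0) ;; Atom (Load 8 1) ;;
     IfGe 8 19 (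
       Atom (Const 11 19) ;; Atom (Load 14 11) ;; Atom (Sub 14 14 2) ;;
       IfLe 14 0 (IfLe 2 0 (Atom (Const 15 1))) ;;
       IfGe 14 1 (IfGe 2 1 (Atom (Const 15 1)))) ;;
     Unless 15 (Atom (Const 7 0))"

lemma form_ge_19_iff: "19 \<le> form u \<longleftrightarrow> u = Halt"
proof (cases u)
  case (Plain a)
  then show ?thesis using basic_form_bounds[of a] by simp
next
  case (Pos a)
  then show ?thesis using basic_form_bounds[of a] by simp
next
  case (Neg a)
  then show ?thesis using basic_form_bounds[of a] by simp
qed simp_all

text \<open>The output is true iff its stamp exceeds \<open>x\<close>, and its expected value is
  \<open>0 < x\<close>, so two sign tests have to agree. The verdict is only ever cleared, which
  accumulates a conjunction over all vectors.\<close>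

lemma wp_check:
  assumes rep: "represents X x \<sigma> m" and pos: "m 1 = int (16 + 4 * p)"
  shows "wp check_com (\<lambda>(m', xs', ys'). xs' = xs \<and> ys' = ys \<and> represents X x \<sigma> m' \<and>
    m' 7 = (if fetch X p = Halt \<and> \<sigma> Out = Some (0 < x) then m 7 else 0) \<and>
    (\<forall>r \<in> {4, 5, 6}. m' r = m r)) (m, xs, ys)"
proof -
  have cells: "m (16 + 4 * p) = form (fetch X p)" "m 2 = int x" "stamped x (\<sigma> Out) (m 19)"
    using rep by (simp_all add: represents_def)
  show ?thesis
  proof (cases "fetch X p = Halt")
    case True
    then show ?thesis
      using rep pos cells by (auto simp: check_com_def stamped_def)
  next
    case False
    then have "\<not> 19 \<le> form (fetch X p)" by (simp add: form_ge_19_iff)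
    with False show ?thesis
      using rep pos cells by (auto simp: check_com_def)
  qed
qed

text \<open>Inputs 1 to \<open>n\<close> are left open because \<open>load_com\<close> overwrites
  them.\<close>

definition ready :: "prim list \<Rightarrow> nat \<Rightarrow> nat \<Rightarrow> (nat \<Rightarrow> int) \<Rightarrow> bool" where
  "ready X n x m \<longleftrightarrow> (\<exists>\<sigma>. represents X x \<sigma> m \<and> (\<forall>i. i = 0 \<or> n < i \<longrightarrow> \<sigma> (In i) = None) \<and>
     \<sigma> Out = Some False \<and> (\<forall>i. \<sigma> (Aux i) = Some False))"

lemma exec_basic_In: "exec_basic a \<sigma> = Some (b, \<sigma>') \<Longrightarrow> \<sigma>' (In i) = \<sigma> (In i)"
  by (cases a) (auto simp: get_reg_def set_reg_def split: option.splits)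

lemma cstep_In: "snd (cstep X c) (In i) = snd c (In i)"
  by (cases c) (auto dest: exec_basic_In split: prim.splits option.splits)

text \<open>No basic instruction writes an input register, so the absent inputs are still absent
  when the next round starts.\<close>

lemma funpow_cstep_In: "snd ((cstep X ^^ N) c) (In i) = snd c (In i)"
  by (induction N) (simp_all add: cstep_In)

text \<open>Every stamp permitted at \<open>x\<close> is at most \<open>x + 1\<close> and hence
  means false at \<open>x + 1\<close>: one addition resets the output and all auxiliary registers,
  whatever the run did.\<close>

lemma ready_next:
  assumes "represents X x \<sigma> m" "\<And>i. i = 0 \<or> n < i \<Longrightarrow> \<sigma> (In i) = None"
  shows "ready X n (Suc x) (m(2 := int (Suc x)))"
proof -
  have "stamped (Suc x) (Some False) v" if "stamped x c v" for c v
    using that by (auto simp: stamped_def)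
  then have "represents X (Suc x) (\<lambda>r. case r of In i \<Rightarrow> \<sigma> (In i) | _ \<Rightarrow> Some False)
    (m(2 := int (Suc x)))"
    using assms(1) unfolding represents_def by (simp del: of_nat_Suc) blast
  with assms(2) show ?thesis
    unfolding ready_def
    by (intro exI[of _ "\<lambda>r. case r of In i \<Rightarrow> \<sigma> (In i) | _ \<Rightarrow> Some False"]) simp
qed

text \<open>The last instruction leaves \<open>2 ^ n\<close> minus the incremented \<open>x\<close>
  in register 0, as the test of the outer loop.\<close>

definition round_com :: com where
  "round_com = load_com ;; simulate_com ;; check_com ;;
     Atom (Const 0 1) ;; Atom (Add 2 2 0) ;; Atom (Sub 0 6 2)"

definition round_time :: "nat \<Rightarrow> nat \<Rightarrow> nat" where
  "round_time n l = (6 + n * 10) + ((3 + l * (clen step_com + 3)) + (clen check_com + 3))"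

lemma within_round:
  assumes ready: "ready X n x m" and x: "x < 2 ^ n" and n: "0 < n"
    and len: "m 5 = int (length X)" "0 < length X" and regs: "m 4 = int n" "m 6 = 2 ^ n"
  shows "within (round_time n (length X)) round_com (\<lambda>(m', xs', ys'). xs' = xs \<and> ys' = ys \<and>
    ready X n (Suc x) m' \<and> m' 7 = (if accepts X (bits n x) then m 7 else 0) \<and>
    (\<forall>r \<in> {4, 5, 6}. m' r = m r) \<and> (0 < m' 0 \<longleftrightarrow> Suc x < 2 ^ n)) (m, xs, ys)"
  (is "within _ _ ?Q _")
proof -
  define bs where "bs = bits n x"
  have bs: "length bs = n" "val bs = x" "bs \<noteq> []"
    using x n by (auto simp: bs_def val_bits simp flip: length_greater_0_conv)
  obtain \<sigma> where \<sigma>: "represents X x \<sigma> m" "\<And>i. i = 0 \<or> n < i \<Longrightarrow> \<sigma> (In i) = None"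
    "\<sigma> Out = Some False" "\<And>i. \<sigma> (Aux i) = Some False"
    using ready unfolding ready_def by blast
  have agree: "\<sigma> r = input_state bs r" if "r \<notin> In ` {1..length bs}" for r
  proof (cases r)
    case (In i)
    with that have "i = 0 \<or> n < i" using bs(1) by force
    with In \<sigma>(2) bs(1) show ?thesis by (auto simp: input_state_def)
  qed (use \<sigma> in \<open>simp_all add: input_state_def\<close>)
  obtain p \<tau> where run: "(cstep X ^^ length X) (0, input_state bs) = (p, \<tau>)" by fastforce
  have \<tau>_In: "\<tau> (In i) = None" if "i = 0 \<or> n < i" for i
    using funpow_cstep_In[of "length X" X "(0, input_state bs)" i] run that bs(1)
    by (auto simp: input_state_def)
  have accepts: "accepts X bs \<longleftrightarrow> fetch X p = Halt \<and> \<tau> Out = Some (0 < x)"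
    by (simp add: accepts_def run tstnz_iff_val bs(2))
  have "within (6 + n * 10) load_com (\<lambda>(m', xs', ys'). xs' = xs \<and> ys' = ys \<and>
    represents X x (input_state bs) m' \<and> (\<forall>r \<in> {4..7}. m' r = m r)) (m, xs, ys)"
    using within_load[of X bs \<sigma> m xs ys] \<sigma>(1) agree bs regs by simp
  then show ?thesis
    unfolding round_com_def round_time_def
  proof (rule within_Seq)
    fix s
    assume "case s of (m', xs', ys') \<Rightarrow> xs' = xs \<and> ys' = ys \<and>
      represents X x (input_state bs) m' \<and> (\<forall>r \<in> {4..7}. m' r = m r)"
    then obtain m1 where s: "s = (m1, xs, ys)" and m1: "represents X x (input_state bs) m1"
      "\<forall>r \<in> {4..7}. m1 r = m r"
      by (cases s) auto
    have "m1 5 = int (length X)" using m1(2) len(1) by simp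
    note simulate = within_simulate[OF m1(1) this len(2) run, of xs ys]
    show "within (3 + length X * (clen step_com + 3) + (clen check_com + 3)) (simulate_com ;;
      check_com ;; Atom (Const 0 1) ;; Atom (Add 2 2 0) ;; Atom (Sub 0 6 2)) ?Q s"
      unfolding s
    proof (rule within_Seq[OF simulate])
      fix s'
      assume "case s' of (m', xs', ys') \<Rightarrow> xs' = xs \<and> ys' = ys \<and> m' 1 = int (16 + 4 * p) \<and>
        represents X x \<tau> m' \<and> (\<forall>r \<in> {4..7}. m' r = m1 r)"
      then obtain m2 where s': "s' = (m2, xs, ys)" and m2: "m2 1 = int (16 + 4 * p)"
        "represents X x \<tau> m2" "\<forall>r \<in> {4..7}. m2 r = m1 r"
        by (cases s') auto
      have "wp (Atom (Const 0 1) ;; Atom (Add 2 2 0) ;; Atom (Sub 0 6 2)) ?Q (m3, xs, ys)"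
        if "represents X x \<tau> m3" "m3 7 = (if accepts X bs then m 7 else 0)"
          "\<forall>r \<in> {4, 5, 6}. m3 r = m r" for m3
      proof -
        have "m3 2 = int x" using that(1) by (simp add: represents_def)
        moreover have "ready X n (Suc x) (m3(0 := v, 2 := int (Suc x), 0 := w))" for v w
          using ready_next[of X x \<tau> "m3(0 := w)" n] that(1) \<tau>_In by (simp add: fun_upd_twist)
        moreover have "1 + int x < 2 ^ n \<longleftrightarrow> Suc x < 2 ^ n"
          using of_nat_less_iff[of "Suc x" "2 ^ n", where 'a = int] by simp
        ultimately show ?thesis using that regs by (simp add: add.commute bs_def)
      qed
      moreover have "wp check_com (\<lambda>(m', xs', ys'). xs' = xs \<and> ys' = ys \<and> represents X x \<tau> m' \<and>
        m' 7 = (if accepts X bs then m 7 else 0) \<and> (\<forall>r \<in> {4, 5, 6}. m' r = m r)) (m2, xs, ys)"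
        by (rule wp_mono[OF wp_check[OF m2(2,1)]]) (use m1(2) m2(3) accepts in auto)
      ultimately have "wp check_com (wp (Atom (Const 0 1) ;; Atom (Add 2 2 0) ;;
        Atom (Sub 0 6 2)) ?Q) (m2, xs, ys)"
        by (elim wp_mono) blast
      then show "within (clen check_com + 3) (check_com ;; Atom (Const 0 1) ;;
        Atom (Add 2 2 0) ;; Atom (Sub 0 6 2)) ?Q s'"
        unfolding s' by (intro within_wp) simp_all
    qed
  qed
qed

text \<open>
  No division is needed for \<open>tstnz_len n\<close>: its increments are alternately 2 and 1, see
  \<open>tstnz_len_Suc\<close>.
\<close>

definition init_com :: com where
  "init_com = (Atom (Read 4) ;; Atom (Read 5) ;; Atom (Const 8 1) ;; Atom (Const 9 3) ;;
       Atom (Const 10 2) ;; Atom (Const 6 1) ;; Atom (Add 5 5 8) ;; Atom (Add 3 4 0)) ;;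
     Repeat (Atom (Add 5 5 10) ;; Atom (Sub 10 9 10) ;; Atom (Add 6 6 6) ;; Atom (Sub 3 3 8)) 3"

lemma tstnz_len_Suc: "tstnz_len (Suc k) = tstnz_len k + (if even k then 2 else 1)"
  by (auto simp: tstnz_len_def elim!: evenE oddE)

text \<open>The length of \<open>X\<close> has to be known in advance, since the input has no end
  marker and reading past its end is an error. Register 5 starts at \<open>k + 1\<close> because
  \<open>tstnz_len 0 = 1\<close>; subtraction from 3 switches the increment between 2 and 1.\<close>

lemma within_init:
  assumes "0 < n"
  shows "within (8 + n * 5) init_com (\<lambda>(m', xs', ys'). xs' = zs \<and> ys' = [] \<and>
    m' 4 = int n \<and> m' 5 = int (tstnz_len n + k) \<and> m' 6 = 2 ^ n \<and> m' 8 = 1 \<and> m' 9 = 3 \<and>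
    (\<forall>r. r = 2 \<or> 16 \<le> r \<longrightarrow> m' r = 0)) (\<lambda>_. 0, int n # int k # zs, [])"
proof -
  define J where "J = (\<lambda>i (m' :: nat \<Rightarrow> int, xs', ys' :: int list). xs' = zs \<and> ys' = [] \<and>
    m' 4 = int n \<and> m' 5 = int (tstnz_len i + k) \<and> m' 6 = 2 ^ i \<and> m' 8 = 1 \<and> m' 9 = 3 \<and>
    m' 3 = int n - int i \<and> m' 10 = (if even i then 2 else 1) \<and>
    (\<forall>r. r = 2 \<or> 16 \<le> r \<longrightarrow> m' r = 0))"
  let ?body = "Atom (Add 5 5 10) ;; Atom (Sub 10 9 10) ;; Atom (Add 6 6 6) ;; Atom (Sub 3 3 8)"
  have "within (n * Suc 4) (Repeat ?body 3) (J n) ((\<lambda>_. 0)(4 := int n, 5 := int k + 1, 8 := 1,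
    9 := 3, 10 := 2, 6 := 1, 3 := int n), zs, [])"
  proof (rule within_Repeat)
    fix i s
    assume "i < n" "J i s"
    then have "wp ?body (\<lambda>s'. J (Suc i) s' \<and> (0 < fst s' 3 \<longleftrightarrow> Suc i < n)) s"
      by (cases s) (auto simp: J_def tstnz_len_Suc)
    then show "within 4 ?body (\<lambda>s'. J (Suc i) s' \<and> (0 < fst s' 3 \<longleftrightarrow> Suc i < n)) s"
      by (rule within_wp) simp
  next
    show "J 0 ((\<lambda>_. 0)(4 := int n, 5 := int k + 1, 8 := 1,
      9 := 3, 10 := 2, 6 := 1, 3 := int n), zs, [])"
      by (simp add: J_def tstnz_len_def)
  qed (use assms in simp)
  then have "within (8 + n * Suc 4) init_com (J n) (\<lambda>_. 0, int n # int k # zs, [])"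
    unfolding init_com_def
    by (intro within_wp_Seq[of _ "n * Suc 4"]) (simp_all add: fun_upd_twist)
  then show ?thesis
    by (rule within_mono) (auto simp: J_def)
qed

text \<open>Registers 8 and 9 still hold 1 and 3 from \<open>init_com\<close>: adding 1 leads from a
  form to its parameter, adding 3 on to the next form.\<close>

definition read_com :: com where
  "read_com = (Atom (Const 0 0) ;; Atom (Const 11 16) ;; Atom (Add 3 5 0)) ;;
     Repeat (Atom (Read 12) ;; Atom (Store 11 12) ;; Atom (Add 11 11 8) ;;
       Atom (Read 12) ;; Atom (Store 11 12) ;; Atom (Add 11 11 9) ;; Atom (Sub 3 3 8)) 3"

text \<open>Cells behind the part read so far hold 0, the code of the default of
  \<open>fetch\<close>, so every prefix of \<open>X\<close> is represented like a complete sequence.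
  This is the invariant of the reading loop.\<close>

lemma represents_snoc:
  assumes "represents Y x \<sigma> m" and "\<And>r. r = 2 \<or> 16 \<le> r \<Longrightarrow>
    m' r = (m(16 + 4 * length Y := form u, 17 + 4 * length Y := param u)) r"
  shows "represents (Y @ [u]) x \<sigma> m'"
proof -
  have "fetch (Y @ [u]) p = (if p = length Y then u else fetch Y p)" for p
    by (auto simp: fetch_def nth_append)
  with assms show ?thesis by (auto simp: represents_def)
qed

lemma within_read:
  assumes regs: "m 5 = int (length X)" "m 8 = 1" "m 9 = 3"
    and zero: "\<forall>r. r = 2 \<or> 16 \<le> r \<longrightarrow> m r = 0" and "X \<noteq> []"
  shows "within (3 + length X * 8) read_com (\<lambda>(m', xs', ys'). ys' = ys \<and> ready X n 0 m' \<and>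
    (\<forall>r \<in> {4..6}. m' r = m r)) (m, concat (map encode_prim X), ys)"
proof -
  define \<sigma> :: state where "\<sigma> = (\<lambda>r. case r of In i \<Rightarrow> None | _ \<Rightarrow> Some False)"
  define J where "J = (\<lambda>k (m', xs', ys'). xs' = concat (map encode_prim (drop k X)) \<and> ys' = ys \<and>
    represents (take k X) 0 \<sigma> m' \<and> m' 11 = int (16 + 4 * k) \<and>
    m' 3 = int (length X) - int k \<and> m' 8 = 1 \<and> m' 9 = 3 \<and> (\<forall>r \<in> {4..6}. m' r = m r))"
  let ?body = "Atom (Read 12) ;; Atom (Store 11 12) ;; Atom (Add 11 11 8) ;;
       Atom (Read 12) ;; Atom (Store 11 12) ;; Atom (Add 11 11 9) ;; Atom (Sub 3 3 8)"
  have "within (length X * Suc 7) (Repeat ?body 3) (J (length X))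
    (m(0 := 0, 11 := 16, 3 := int (length X)), concat (map encode_prim X), ys)"
  proof (rule within_Repeat)
    fix k s
    assume k: "k < length X" and "J k s"
    define zs where "zs = concat (map encode_prim (drop (Suc k) X))"
    have "concat (map encode_prim (drop k X)) = form (X ! k) # param (X ! k) # zs"
      by (subst Cons_nth_drop_Suc[OF k, symmetric]) (simp add: encode_prim_eq zs_def)
    with \<open>J k s\<close> obtain m1 where s: "s = (m1, form (X ! k) # param (X ! k) # zs, ys)"
      and J: "represents (take k X) 0 \<sigma> m1" "m1 11 = 16 + 4 * int k"
        "m1 3 = int (length X) - int k" "m1 8 = 1" "m1 9 = 3" "\<forall>r \<in> {4..6}. m1 r = m r"
      by (cases s) (auto simp: J_def)
    have rep: "represents (take (Suc k) X) 0 \<sigma> m'" if "\<forall>r. r = 2 \<or> 16 \<le> r \<longrightarrow>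
      m' r = (m1(16 + 4 * k := form (X ! k), 17 + 4 * k := param (X ! k))) r" for m'
      using represents_snoc[OF J(1), of m' "X ! k"] that k
      by (simp add: take_Suc_conv_app_nth del: fun_upd_apply)
    have "wp ?body (\<lambda>(m', xs', ys'). xs' = zs \<and> ys' = ys \<and>
      (\<forall>r. r = 2 \<or> 16 \<le> r \<longrightarrow>
         m' r = (m1(16 + 4 * k := form (X ! k), 17 + 4 * k := param (X ! k))) r) \<and>
      m' 11 = int (16 + 4 * Suc k) \<and> m' 3 = int (length X) - int (Suc k) \<and>
      m' 8 = 1 \<and> m' 9 = 3 \<and> (\<forall>r \<in> {4..6}. m' r = m r)) s"
      unfolding s using J(2-6) by auto
    then have "wp ?body (\<lambda>s'. J (Suc k) s' \<and> (0 < fst s' 3 \<longleftrightarrow> Suc k < length X)) s"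
    proof (rule wp_mono, clarify, goal_cases)
      case (1 m')
      with rep[of m'] show ?case by (auto simp: J_def zs_def)
    qed
    then show "within 7 ?body (\<lambda>s'. J (Suc k) s' \<and> (0 < fst s' 3 \<longleftrightarrow> Suc k < length X)) s"
      by (rule within_wp) simp
  next
    \<comment> \<open>Zero cells are the code of the empty sequence, of absent inputs, and of output
      and auxiliary registers that are false.\<close>
    have "represents [] 0 \<sigma> m"
      using zero by (auto simp: represents_def fetch_def stamped_def \<sigma>_def)
    then show "J 0 (m(0 := 0, 11 := 16, 3 := int (length X)), concat (map encode_prim X), ys)"
      using regs by (simp add: J_def)
  qed (use \<open>X \<noteq> []\<close> in simp)
  then have "within (3 + length X * Suc 7) read_com (J (length X))
    (m, concat (map encode_prim X), ys)"
    unfolding read_com_def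
    by (intro within_wp_Seq[of _ "length X * Suc 7"]) (use regs(1) in simp_all)
  then show ?thesis
    by (rule within_mono) (auto simp: J_def ready_def \<sigma>_def)
qed

section \<open>The decision procedure and its running time\<close>

definition decide_com :: com where
  "decide_com = init_com ;; read_com ;; Atom (Const 7 1) ;; Repeat round_com 0 ;; Atom (Print 7)"

lemma ready_frame: "r < 16 \<Longrightarrow> r \<noteq> 2 \<Longrightarrow> ready X n x (m(r := v)) \<longleftrightarrow> ready X n x m"
  by (simp add: ready_def)

lemma within_decide:
  assumes n: "0 < n" and X: "X \<noteq> []" and len: "length X = tstnz_len n + k"
  shows "within ((8 + n * 5) + ((3 + length X * 8) + (1 + (2 ^ n * Suc (round_time n (length X)) + 1))))
    decide_com (\<lambda>s. snd (snd s) = [if \<forall>bs. length bs = n \<longrightarrow> accepts X bs then 1 else 0])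
    (\<lambda>_. 0, encode_input n k X, [])"
  unfolding decide_com_def encode_input_def
proof (rule within_Seq, rule within_init[OF n], goal_cases)
  case (1 s)
  then obtain m where s: "s = (m, concat (map encode_prim X), [])"
    and m: "m 4 = int n" "m 5 = int (length X)" "m 6 = 2 ^ n" "m 8 = 1" "m 9 = 3"
      "\<forall>r. r = 2 \<or> 16 \<le> r \<longrightarrow> m r = 0"
    using len by (cases s) auto
  show ?case
  proof (rule within_Seq, unfold s, rule within_read[OF m(2,4-6) X, where n = n], goal_cases)
    case (1 s1)
    then obtain m1 xs where s1: "s1 = (m1, xs, [])"
      and m1: "ready X n 0 m1" "m1 4 = int n" "m1 5 = int (length X)" "m1 6 = 2 ^ n"
      using m by (cases s1) auto
    define J where "J = (\<lambda>x (m', xs' :: int list, ys'). xs' = xs \<and> ys' = ([] :: int list) \<and>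
      ready X n x m' \<and> m' 7 = (if \<forall>y<x. accepts X (bits n y) then 1 else (0 :: int)) \<and>
      m' 4 = int n \<and> m' 5 = int (length X) \<and> m' 6 = 2 ^ n)"
    have "within (2 ^ n * Suc (round_time n (length X))) (Repeat round_com 0) (J (2 ^ n))
      (m1(7 := 1), xs, [])"
    proof (rule within_Repeat)
      fix x s
      assume x: "x < 2 ^ n" and "J x s"
      then obtain m2 where s2: "s = (m2, xs, [])" and m2: "ready X n x m2"
        "m2 7 = (if \<forall>y<x. accepts X (bits n y) then 1 else 0)"
        "m2 4 = int n" "m2 5 = int (length X)" "m2 6 = 2 ^ n"
        by (cases s) (auto simp: J_def)
      show "within (round_time n (length X)) round_com
        (\<lambda>s'. J (Suc x) s' \<and> (0 < fst s' 0 \<longleftrightarrow> Suc x < 2 ^ n)) s"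
        unfolding s2
        by (rule within_mono[OF within_round[OF m2(1) x n m2(4) _ m2(3,5)]])
          (use X m2 in \<open>auto simp: J_def less_Suc_eq\<close>)
    next
      show "J 0 (m1(7 := 1), xs, [])"
        using m1 by (simp add: J_def ready_frame)
    qed simp
    moreover have "within 1 (Atom (Print 7)) (\<lambda>s. snd (snd s) =
      [if \<forall>bs. length bs = n \<longrightarrow> accepts X bs then 1 else 0]) s'" if "J (2 ^ n) s'" for s'
      using that all_bits_iff[of n "accepts X"]
      by (intro within_wp; cases s') (auto simp: J_def)
    ultimately have "within (2 ^ n * Suc (round_time n (length X)) + 1)
      (Repeat round_com 0 ;; Atom (Print 7)) (\<lambda>s. snd (snd s) =
        [if \<forall>bs. length bs = n \<longrightarrow> accepts X bs then 1 else 0]) (m1(7 := 1), xs, [])"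
      by (rule within_Seq)
    then show ?case
      unfolding s1 by (intro within_wp_Seq) simp_all
  qed
qed

lemma tstnz_len_le: "0 < n \<Longrightarrow> tstnz_len n \<le> 3 * n"
  by (auto simp: tstnz_len_def elim!: evenE oddE)

lemma time_bound:
  assumes "0 < n" "l = tstnz_len n + k"
  shows "(8 + n * 5) + ((3 + l * 8) + (1 + (2 ^ n * Suc (round_time n l) + 1)))
    \<le> (74 + 3 * clen step_com + clen check_com) * ((n + k) * 2 ^ n)"
proof -
  \<comment> \<open>31 + 1 = 13 + 10 + 9: 13 fixed instructions per round, 10 per input bit, and an
    overhead of 3 for each of at most \<open>3 * (n + k)\<close> simulated steps. With the 42 below
    this gives 74.\<close>
  let ?K = "31 + 3 * clen step_com + clen check_com"
  have l: "l \<le> 3 * (n + k)" using tstnz_len_le[OF assms(1)] assms(2) by simp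
  obtain j where j: "n + k = Suc j" using assms(1) by (cases "n + k") auto
  have "l * (clen step_com + 3) \<le> 3 * (n + k) * (clen step_com + 3)"
    using l by (rule mult_le_mono1)
  moreover have "c \<le> c * (n + k)" for c :: nat
    using j by simp
  from this[of "13 + clen check_com"] have "13 + clen check_com \<le> (13 + clen check_com) * (n + k)" .
  ultimately have "Suc (round_time n l) \<le> ?K * (n + k) + (n + k)"
    by (simp add: round_time_def algebra_simps)
  then have "2 ^ n * Suc (round_time n l) \<le> 2 ^ n * ((?K + 1) * (n + k))"
    by (intro mult_le_mono2) (simp add: algebra_simps)
  \<comment> \<open>42 = 13 + 5 + 8 * 3, using \<open>l \<le> 3 * (n + k)\<close> and
    \<open>1 \<le> n + k\<close>.\<close>
  moreover have "(8 + n * 5) + (3 + l * 8) + 2 \<le> 42 * (n + k)"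
    using l j by simp
  moreover have "42 * (n + k) \<le> 42 * (n + k) * 2 ^ n"
    by simp
  ultimately show ?thesis by (simp add: algebra_simps)
qed

theorem theorem6:
  "\<exists>(P :: ram_instr list) (C :: nat). \<forall>(n :: nat) (m :: nat) (X :: prim list).
     1 \<le> n \<longrightarrow> 1 \<le> m \<longrightarrow> X \<in> IS \<longrightarrow> length X = tstnz_len n + m \<longrightarrow>
     (\<exists>t \<le> C * ((n + m) * 2 ^ n).
        ram_maps P t (encode_input n m X) [if computes n X tstnz then 1 else 0])"
proof (rule exI[of _ "compile decide_com 0"],
    rule exI[of _ "74 + 3 * clen step_com + clen check_com"], intro allI impI)
  fix n m :: nat and X :: "prim list"
  assume "1 \<le> n" "1 \<le> m" "X \<in> IS" and len: "length X = tstnz_len n + m"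
  then have n: "0 < n" and X: "X \<noteq> []" by auto
  have "within ((74 + 3 * clen step_com + clen check_com) * ((n + m) * 2 ^ n)) decide_com
    (\<lambda>s. snd (snd s) = [if computes n X tstnz then 1 else 0]) (\<lambda>_. 0, encode_input n m X, [])"
    using within_mono[OF within_decide[OF n X len] time_bound[OF n len]]
    by (simp add: computes_iff_accepts[OF \<open>X \<in> IS\<close>])
  then show "\<exists>t\<le>(74 + 3 * clen step_com + clen check_com) * ((n + m) * 2 ^ n).
    ram_maps (compile decide_com 0) t (encode_input n m X) [if computes n X tstnz then 1 else 0]"
    by (rule within_imp_ram_maps)
qed

end
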